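(* Fix a player $i\in\mathsf N$. Let $\delta^i>0$ and $F^{-i}=(F^j)_{j\ne i}$, $F^j\in\mathbb{R}^{m_j\times s_j}$, be given, and set $A^i:=A+\sum_{j\neq i}B^jF^jC^j$. For symmetric $X,Y\in\mathbb{R}^{n\times n}$ define $$\Phi_1^i(X):=\begin{bmatrix}-X&{A^i}^\top X&(\sqrt{Q^i}C^i)^\top&0_{n\times m_i}\\ XA^i&-X&0_{n\times s_i}&0_{n\times m_i}\\ \sqrt{Q^i}C^i&0_{s_i\times n}&-I_{s_i}&0_{s_i\times m_i}\\ 0_{m_i\times n}&0_{m_i\times n}&0_{m_i\times s_i}&-(R^i)^{-1}\end{bmatrix},$$ $$\Phi_2^i(Y):=\begin{bmatrix}-Y&Y{A^i}^\top&(\sqrt{Q^i}C^iY)^\top&0_{n\times m_i}\\ A^iY&-Y&0_{n\times s_i}&0_{n\times m_i}\\ \sqrt{Q^i}C^iY&0_{s_i\times n}&-I_{s_i}&0_{s_i\times m_i}\\ 0_{m_i\times n}&0_{m_i\times n}&0_{m_i\times s_i}&-(R^i)^{-1}\end{bmatrix}.$$ Let $\tilde C^i:=\begin{bmatrix}C^i&0_{s_i\times n}&0_{s_i\times s_i}&0_{s_i\times m_i}\end{bmatrix}$ and $\tilde B^i:=\begin{bmatrix}0_{m_i\times n}&{B^i}^\top&0_{m_i\times s_i}&I_{m_i}\end{bmatrix}$, and let $\mathcal N_{\tilde C^i}$, $\mathcal N_{\tilde B^i}$ be matrices with orthonormal columns spanning the null spaces of $\tilde C^i$ and $\tilde B^i$,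 respectively. Define $$\mathscr X^i:=\{X\in\mathbb{R}^{n\times n}: X\succ0,\ \mathcal N_{\tilde C^i}^\top\Phi^i_1(X)\mathcal N_{\tilde C^i}\prec0\},$$ $$\mathscr Y^i:=\Big\{Y\in\mathbb{R}^{n\times n}: Y\succ0,\ \begin{bmatrix}\delta^i&x_0^\top\\ x_0&Y\end{bmatrix}\succ0,\ \mathcal N_{\tilde B^i}^\top\Phi^i_2(Y)\mathcal N_{\tilde B^i}\prec0\Big\},$$ $$\mathscr P^i:=\{P^i\in\mathbb{R}^{n\times n}: P^i\succ0,\ P^i\in\mathscr X^i,\ (P^i)^{-1}\in\mathscr Y^i\}.$$ Then $\mathfrak g^i(\delta^i,F^{-i})\ne\emptyset$, with $\sigma(A^i+B^iF^iC^i)\subset\mathbb{D}$ for every $F^i\in\mathfrak g^i(\delta^i,F^{-i})$, if and only if $\mathscr P^i\neq\emptyset$. In this case, any $F^i\in\mathfrak g^i(\delta^i,F^{-i})$ satisfies the following linear matrix inequality for some $P^i\in\mathscr P^i$: $$\begin{bmatrix}-P^i&(A^i+B^iF^iC^i)^\top P^i&(\sqrt{Q^i}C^i)^\top&(\sqrt{R^i}F^iC^i)^\top\\ P^i(A^i+B^iF^iC^i)&-P^i&0_{n\times s_i}&0_{n\times m_i}\\ \sqrt{Q^i}C^i&0_{s_i\times n}&-I_{s_i}&0_{s_i\times m_i}\\ \sqrt{R^i}F^iC^i&0_{m_i\times n}&0_{m_i\times s_i}&-I_{m_i}\end{bmatrix}\prec0.$$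
   Context: Players: $\mathsf N=\{1,\dots,N\}$. Discrete-time game: $x_{k+1}=Ax_k+\sum_{i\in\mathsf N}B^iu^i_k$, $k\in\{0,1,2,\dots\}$, with given initial condition $x_0\in\mathbb{R}^n$, $A\in\mathbb{R}^{n\times n}$, $B^i\in\mathbb{R}^{n\times m_i}$. Player $i$ observes $y^i_k=C^ix_k$, where $C^i\in\mathbb{R}^{s_i\times n}$ has rank $s_i\le n$, and uses static output feedback $u^i_k=F^iy^i_k$, $F^i\in\mathbb{R}^{m_i\times s_i}$. Weights: $Q^i\in\mathbb{R}^{s_i\times s_i}$ symmetric, $Q^i\succeq0$; $R^i\in\mathbb{R}^{m_i\times m_i}$ symmetric, $R^i\succ0$; $\sqrt{Q^i},\sqrt{R^i}$ denote the symmetric positive semidefinite square roots. The cost of player $i$ is $$J^i(F^i,F^{-i})=\sum_{k=0}^\infty x_k^\top\big({C^i}^\top Q^iC^i+{C^i}^\top{F^i}^\top R^iF^iC^i\big)x_k,$$ where $x_{k+1}=(A+\sum_{j\in\mathsf N}B^jF^jC^j)x_k$ with initial condition $x_0$. $F^{-i}$ denotes the strategies of all players other than $i$. $\mathbb{D}=\{\lambda\in\mathbb{C}:|\lambda|<1\}$ and $\sigma(\cdot)$ is the spectrum. $M\succ0$ ($\prec0$) means symmetric positive (negative) definite. The set of stabilizing profiles $\mathscr F=\{(F^1,\dots,F^N):\sigma(A+\sum_{i\in\mathsf N}B^iF^iC^i)\subset\mathbb{D}\}$ is assumed non-empty. Guaranteed cost response: $\mathfrak g^i(\delta^i,F^{-i})=\{F^i\in\mathbb{R}^{m_i\times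 s_i}: J^i(F^i,F^{-i})<\delta^i,\ (F^i,F^{-i})\in\mathscr F\}$. *)

theory Defs
  imports
    "HOL-Library.Extended_Real"
    "Jordan_Normal_Form.Spectral_Radius"
    "Jordan_Normal_Form.Gauss_Jordan_Elimination"
    "Jordan_Normal_Form.Matrix_Kernel"
    "Jordan_Normal_Form.DL_Rank"
begin

section \<open>Definite matrices, square roots, inverses\<close>

definition symmetric :: "real mat \<Rightarrow> bool" where
  "symmetric M \<longleftrightarrow> square_mat M \<and> M\<^sup>T = M"

definition pos_def :: "real mat \<Rightarrow> bool" where
  "pos_def M \<longleftrightarrow> symmetric M \<and>
     (\<forall>v \<in> carrier_vec (dim_row M). v \<noteq> 0\<^sub>v (dim_row M) \<longrightarrow> v \<bullet> (M *\<^sub>v v) > 0)"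

definition pos_semidef :: "real mat \<Rightarrow> bool" where
  "pos_semidef M \<longleftrightarrow> symmetric M \<and> (\<forall>v \<in> carrier_vec (dim_row M). v \<bullet> (M *\<^sub>v v) \<ge> 0)"

definition neg_def :: "real mat \<Rightarrow> bool" where
  "neg_def M \<longleftrightarrow> symmetric M \<and>
     (\<forall>v \<in> carrier_vec (dim_row M). v \<noteq> 0\<^sub>v (dim_row M) \<longrightarrow> v \<bullet> (M *\<^sub>v v) < 0)"

definition psd_sqrt :: "real mat \<Rightarrow> real mat" where
  "psd_sqrt Q = (THE S. S \<in> carrier_mat (dim_row Q) (dim_row Q) \<and> pos_semidef S \<and> S * S = Q)"

text \<open>Only meaningful for invertible matrices (unspecified otherwise).\<close>

abbreviation mat_inv :: "real mat \<Rightarrow> real mat" where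
  "mat_inv M \<equiv> the (mat_inverse M)"

section \<open>Block matrices and null spaces\<close>

definition append_cols :: "real mat \<Rightarrow> real mat \<Rightarrow> real mat" (infixr \<open>@\<^sub>c\<close> 65) where
  "M @\<^sub>c M' = four_block_mat M M' (0\<^sub>m 0 (dim_col M)) (0\<^sub>m 0 (dim_col M'))"

text \<open>The 4-by-4 block matrix whose blocks are listed row by row.\<close>

definition block4 ::
  "real mat \<Rightarrow> real mat \<Rightarrow> real mat \<Rightarrow> real mat \<Rightarrow>
   real mat \<Rightarrow> real mat \<Rightarrow> real mat \<Rightarrow> real mat \<Rightarrow>
   real mat \<Rightarrow> real mat \<Rightarrow> real mat \<Rightarrow> real mat \<Rightarrow>
   real mat \<Rightarrow> real mat \<Rightarrow> real mat \<Rightarrow> real mat \<Rightarrow> real mat" where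
  "block4 a11 a12 a13 a14
          a21 a22 a23 a24
          a31 a32 a33 a34
          a41 a42 a43 a44 =
     four_block_mat
       (four_block_mat a11 a12 a21 a22) (four_block_mat a13 a14 a23 a24)
       (four_block_mat a31 a32 a41 a42) (four_block_mat a33 a34 a43 a44)"

definition orthonormal_kernel_basis :: "real mat \<Rightarrow> real mat \<Rightarrow> bool" where
  "orthonormal_kernel_basis K M \<longleftrightarrow>
     dim_row K = dim_col M \<and>
     K\<^sup>T * K = 1\<^sub>m (dim_col K) \<and>
     vec_space.col_space (dim_col M) K = mat_kernel M"

section \<open>The game\<close>

text \<open>The players are \<open>1, \<dots>, N\<close>; a strategy profile is a function on player indices, whose
  values outside \<open>{1..N}\<close> are irrelevant.\<close>

text \<open>\<open>A\<close> plus the sum of \<open>B\<^sup>j F\<^sup>j C\<^sup>j\<close> over \<open>j \<in> J\<close>, the sum being taken entrywise because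
  matrices of unspecified dimension do not form a \<open>comm_monoid_add\<close>.\<close>

definition feedback_mat ::
  "nat set \<Rightarrow> real mat \<Rightarrow> (nat \<Rightarrow> real mat) \<Rightarrow> (nat \<Rightarrow> real mat) \<Rightarrow> (nat \<Rightarrow> real mat) \<Rightarrow> real mat" where
  "feedback_mat J A B C F =
     A + mat (dim_row A) (dim_col A) (\<lambda>(r, c). \<Sum>j\<in>J. (B j * F j * C j) $$ (r, c))"

primrec trajectory :: "real mat \<Rightarrow> real vec \<Rightarrow> nat \<Rightarrow> real vec" where
  "trajectory M x0 0 = x0"
| "trajectory M x0 (Suc k) = M *\<^sub>v trajectory M x0 k"

text \<open>The infinite sum is taken in the extended reals, so that a divergent cost is \<open>\<infinity>\<close>.\<close>

definition cost ::
  "nat \<Rightarrow> real mat \<Rightarrow> (nat \<Rightarrow> real mat) \<Rightarrow> (nat \<Rightarrow> real mat) \<Rightarrow> (nat \<Rightarrow> real mat) \<Rightarrow>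
   (nat \<Rightarrow> real mat) \<Rightarrow> real vec \<Rightarrow> nat \<Rightarrow> (nat \<Rightarrow> real mat) \<Rightarrow> ereal" where
  "cost N A B C Q R x0 i F =
     (let x = trajectory (feedback_mat {1..N} A B C F) x0;
          W = (C i)\<^sup>T * Q i * C i + (C i)\<^sup>T * (F i)\<^sup>T * R i * F i * C i
      in (\<Sum>k. ereal (x k \<bullet> (W *\<^sub>v x k))))"

definition open_unit_disc :: "complex set" where
  "open_unit_disc = {z. cmod z < 1}"

text \<open>The spectrum of a real matrix as a complex matrix, including non-real eigenvalues.\<close>

definition complex_spectrum :: "real mat \<Rightarrow> complex set" where
  "complex_spectrum M = spectrum (map_mat complex_of_real M)"

definition stabilizing_profiles ::
  "nat \<Rightarrow> (nat \<Rightarrow> nat) \<Rightarrow> (nat \<Rightarrow> nat) \<Rightarrow> real mat \<Rightarrow> (nat \<Rightarrow> real mat) \<Rightarrow> (nat \<Rightarrow> real mat) \<Rightarrow>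
   (nat \<Rightarrow> real mat) set" where
  "stabilizing_profiles N m s A B C =
     {F. (\<forall>j\<in>{1..N}. F j \<in> carrier_mat (m j) (s j)) \<and>
         complex_spectrum (feedback_mat {1..N} A B C F) \<subseteq> open_unit_disc}"

text \<open>The strategies of the players other than \<open>i\<close> are the values of \<open>F\<close> off \<open>i\<close>; the value
  \<open>F i\<close> is overwritten and hence irrelevant.\<close>

definition guaranteed_cost_response ::
  "nat \<Rightarrow> (nat \<Rightarrow> nat) \<Rightarrow> (nat \<Rightarrow> nat) \<Rightarrow> real mat \<Rightarrow> (nat \<Rightarrow> real mat) \<Rightarrow> (nat \<Rightarrow> real mat) \<Rightarrow>
   (nat \<Rightarrow> real mat) \<Rightarrow> (nat \<Rightarrow> real mat) \<Rightarrow> real vec \<Rightarrow> nat \<Rightarrow> real \<Rightarrow> (nat \<Rightarrow> real mat) \<Rightarrow>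
   real mat set" where
  "guaranteed_cost_response N m s A B C Q R x0 i \<delta> F =
     {K \<in> carrier_mat (m i) (s i).
        cost N A B C Q R x0 i (F(i := K)) < ereal \<delta> \<and>
        F(i := K) \<in> stabilizing_profiles N m s A B C}"

section \<open>The matrix inequalities of a single player\<close>

text \<open>Below, \<open>A\<close> is the matrix seen by the player once the other strategies are fixed,
  \<open>B\<close>, \<open>C\<close>, \<open>Q\<close>, \<open>R\<close> are the player's own matrices, and \<open>n\<close>, \<open>m\<close>, \<open>s\<close> are the
  dimensions of the state, of the player's input and of the player's output.\<close>

definition Phi1 :: "nat \<Rightarrow> nat \<Rightarrow> nat \<Rightarrow> real mat \<Rightarrow> real mat \<Rightarrow> real mat \<Rightarrow> real mat \<Rightarrow> real mat \<Rightarrow> real mat" where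
  "Phi1 n m s A C Q R X =
     block4 (- X)            (A\<^sup>T * X)    ((psd_sqrt Q * C)\<^sup>T) (0\<^sub>m n m)
            (X * A)          (- X)       (0\<^sub>m n s)            (0\<^sub>m n m)
            (psd_sqrt Q * C) (0\<^sub>m s n)    (- 1\<^sub>m s)           (0\<^sub>m s m)
            (0\<^sub>m m n)         (0\<^sub>m m n)    (0\<^sub>m m s)            (- mat_inv R)"

definition Phi2 :: "nat \<Rightarrow> nat \<Rightarrow> nat \<Rightarrow> real mat \<Rightarrow> real mat \<Rightarrow> real mat \<Rightarrow> real mat \<Rightarrow> real mat \<Rightarrow> real mat" where
  "Phi2 n m s A C Q R Y =
     block4 (- Y)                (Y * A\<^sup>T)    ((psd_sqrt Q * C * Y)\<^sup>T) (0\<^sub>m n m)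
            (A * Y)              (- Y)       (0\<^sub>m n s)                (0\<^sub>m n m)
            (psd_sqrt Q * C * Y) (0\<^sub>m s n)    (- 1\<^sub>m s)               (0\<^sub>m s m)
            (0\<^sub>m m n)             (0\<^sub>m m n)    (0\<^sub>m m s)                (- mat_inv R)"

definition C_tilde :: "nat \<Rightarrow> nat \<Rightarrow> nat \<Rightarrow> real mat \<Rightarrow> real mat" where
  "C_tilde n m s C = C @\<^sub>c 0\<^sub>m s n @\<^sub>c 0\<^sub>m s s @\<^sub>c 0\<^sub>m s m"

definition B_tilde :: "nat \<Rightarrow> nat \<Rightarrow> nat \<Rightarrow> real mat \<Rightarrow> real mat" where
  "B_tilde n m s B = 0\<^sub>m m n @\<^sub>c B\<^sup>T @\<^sub>c 0\<^sub>m m s @\<^sub>c 1\<^sub>m m"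

text \<open>\<open>NC\<close> and \<open>NB\<close> stand for the chosen orthonormal bases of the null spaces of \<open>C_tilde\<close> and
  \<open>B_tilde\<close>.\<close>

definition set_X ::
  "nat \<Rightarrow> nat \<Rightarrow> nat \<Rightarrow> real mat \<Rightarrow> real mat \<Rightarrow> real mat \<Rightarrow> real mat \<Rightarrow> real mat \<Rightarrow> real mat set" where
  "set_X n m s A C Q R NC =
     {X \<in> carrier_mat n n. pos_def X \<and> neg_def (NC\<^sup>T * Phi1 n m s A C Q R X * NC)}"

definition set_Y ::
  "nat \<Rightarrow> nat \<Rightarrow> nat \<Rightarrow> real mat \<Rightarrow> real mat \<Rightarrow> real mat \<Rightarrow> real mat \<Rightarrow> real vec \<Rightarrow> real \<Rightarrow> real mat \<Rightarrow>
   real mat set" where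
  "set_Y n m s A C Q R x0 \<delta> NB =
     {Y \<in> carrier_mat n n. pos_def Y \<and>
        pos_def (four_block_mat (mat 1 1 (\<lambda>_. \<delta>)) (mat_of_rows n [x0])
                                (mat_of_cols n [x0]) Y) \<and>
        neg_def (NB\<^sup>T * Phi2 n m s A C Q R Y * NB)}"

definition set_P ::
  "nat \<Rightarrow> nat \<Rightarrow> nat \<Rightarrow> real mat \<Rightarrow> real mat \<Rightarrow> real mat \<Rightarrow> real mat \<Rightarrow> real vec \<Rightarrow> real \<Rightarrow>
   real mat \<Rightarrow> real mat \<Rightarrow> real mat set" where
  "set_P n m s A C Q R x0 \<delta> NC NB =
     {P \<in> carrier_mat n n. pos_def P \<and> P \<in> set_X n m s A C Q R NC \<and>
        mat_inv P \<in> set_Y n m s A C Q R x0 \<delta> NB}"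

definition lmi_mat ::
  "nat \<Rightarrow> nat \<Rightarrow> nat \<Rightarrow> real mat \<Rightarrow> real mat \<Rightarrow> real mat \<Rightarrow> real mat \<Rightarrow> real mat \<Rightarrow> real mat \<Rightarrow> real mat \<Rightarrow>
   real mat" where
  "lmi_mat n m s A B C Q R P F =
     block4 (- P)                 ((A + B * F * C)\<^sup>T * P) ((psd_sqrt Q * C)\<^sup>T) ((psd_sqrt R * F * C)\<^sup>T)
            (P * (A + B * F * C)) (- P)                  (0\<^sub>m n s)            (0\<^sub>m n m)
            (psd_sqrt Q * C)      (0\<^sub>m s n)               (- 1\<^sub>m s)           (0\<^sub>m s m)
            (psd_sqrt R * F * C)  (0\<^sub>m m n)               (0\<^sub>m m s)            (- 1\<^sub>m m)"

end

theory Submission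
  imports Defs
begin

text \<open>Write \<open>h L v\<close> (\<open>closed_loop_form\<close>) for the change of the Lyapunov function \<open>v \<bullet> Pv\<close> along one step of the state
  feedback \<open>u = Lx\<close> plus the stage cost. Completing squares turns membership in \<open>\<X>\<close> into
  \<open>h 0 v < 0\<close> on \<open>ker C - {0}\<close>, and membership of \<open>P\<^sup>-\<^sup>1\<close> in \<open>\<Y>\<close> into \<open>x0 \<bullet> P x0 < \<delta>\<close>
  together with \<open>h L v < 0\<close> for some state feedback \<open>L\<close>, equivalently for the minimiser \<open>L\<close> of \<open>h\<close>;
  the full matrix inequality says \<open>h (K C) v < 0\<close>. If \<open>K\<close> is a guaranteed cost response, such a \<open>P\<close>
  is the Lyapunov solution of the closed loop for a slightly enlarged weight. Conversely, given \<open>P\<close>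
  and the minimiser \<open>L\<close>, let \<open>\<Pi>\<close> be the projection along \<open>ker C\<close> that is orthogonal for the
  positive definite form \<open>- h L\<close>. Since \<open>C\<close> has full row rank, \<open>K C = L \<Pi>\<close> has a solution \<open>K\<close>,
  and \<open>h (K C) v = h L (\<Pi> v) + h 0 (v - \<Pi> v) < 0\<close>.\<close>

section \<open>Real vectors\<close>

text \<open>In the second inequality the input matrix appears only through the null space of
  \<open>B_tilde\<close>, that is, through the constraint v4 = - B^T v2. Its multiplier is a free
  state gain: adding 0 = 2 (B^T v2 + v4) . L u leaves the form unchanged, so the form is at most
  \<open>h L u\<close> for every L, with equality at a suitable point when L is the minimiser. This
  duality is why negativity for some L and for the minimiser say the same. An output gain can be
  glued from L and 0 because, at the minimiser, the linear term in a change of gain vanishes: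
  replacing L v by L v + e raises the form by an amount that depends on e alone. With d = v - \<Pi>
  v, the gain K C at v and the gain 0 at d both deviate from L by e = - L d; the two amounts cancel,
  and what is left splits by orthogonality. The obstacle in the direction from gains to certificates
  is strictness: the stage cost is only semidefinite, so its Lyapunov solution may be singular and
  gives equality instead of \<open>< 0\<close>. The strict gap between the cost and \<delta> pays
  for the enlarged weight.\<close>

lemma scalar_prod_self_nonneg: "(v :: real vec) \<bullet> v \<ge> 0"
  by (auto simp: scalar_prod_def intro!: sum_nonneg)

lemma scalar_prod_self_eq_0:
  assumes "(v :: real vec) \<in> carrier_vec n"
  shows "v \<bullet> v = 0 \<longleftrightarrow> v = 0\<^sub>v n"
proof -
  have "v \<bullet> v = 0 \<longleftrightarrow> (\<forall>i\<in>{0..<n}. v $ i * v $ i = 0)"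
    unfolding scalar_prod_def using assms by (subst sum_nonneg_eq_0_iff) auto
  also have "\<dots> \<longleftrightarrow> v = 0\<^sub>v n" using assms by (auto simp: vec_eq_iff)
  finally show ?thesis .
qed

lemma scalar_prod_self_pos:
  assumes "(v :: real vec) \<in> carrier_vec n" "v \<noteq> 0\<^sub>v n"
  shows "v \<bullet> v > 0"
  using scalar_prod_self_nonneg[of v] scalar_prod_self_eq_0[OF assms(1)] assms(2) by linarith

lemma adjoint_right:
  assumes "(A :: real mat) \<in> carrier_mat nr nc" "x \<in> carrier_vec nc" "y \<in> carrier_vec nr"
  shows "x \<bullet> (A\<^sup>T *\<^sub>v y) = y \<bullet> (A *\<^sub>v x)"
  using transpose_vec_mult_scalar[OF assms] comm_scalar_prod[of x nc "A\<^sup>T *\<^sub>v y"] assms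
  by (simp add: mult_mat_vec_carrier[of _ nc nr])

lemma scalar_prod_add_self:
  assumes "(x :: real vec) \<in> carrier_vec n" "y \<in> carrier_vec n"
  shows "(x + y) \<bullet> (x + y) = x \<bullet> x + 2 * (x \<bullet> y) + y \<bullet> y"
  using assms comm_scalar_prod[OF assms]
  by (simp add: add_scalar_prod_distrib[of _ n] scalar_prod_add_distrib[of _ n])

lemma mat_eqI_mult_vec:
  assumes A: "(A :: real mat) \<in> carrier_mat nr nc" and B: "B \<in> carrier_mat nr nc"
    and eq: "\<And>v. v \<in> carrier_vec nc \<Longrightarrow> A *\<^sub>v v = B *\<^sub>v v"
  shows "A = B"
proof (rule eq_matI)
  fix i j assume ij: "i < dim_row B" "j < dim_col B"
  have "(A *\<^sub>v unit_vec nc j) $ i = (B *\<^sub>v unit_vec nc j) $ i" using eq[of "unit_vec nc j"] by simp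
  thus "A $$ (i, j) = B $$ (i, j)" using A B ij by auto
qed (use A B in auto)

section \<open>Symmetric and definite matrices\<close>

lemma symmetric_carrier:
  assumes "A \<in> carrier_mat n n"
  shows "symmetric A \<longleftrightarrow> A\<^sup>T = A"
  using assms by (auto simp: symmetric_def)

lemma symmetric_swap:
  assumes "symmetric A" "A \<in> carrier_mat n n" "x \<in> carrier_vec n" "y \<in> carrier_vec n"
  shows "x \<bullet> (A *\<^sub>v y) = y \<bullet> (A *\<^sub>v x)"
  using adjoint_right[OF assms(2-4)] assms(1) by (simp add: symmetric_def)

lemma quad_add:
  assumes "symmetric A" "A \<in> carrier_mat n n" "x \<in> carrier_vec n" "y \<in> carrier_vec n"
  shows "(x + y) \<bullet> (A *\<^sub>v (x + y)) = x \<bullet> (A *\<^sub>v x) + 2 * (x \<bullet> (A *\<^sub>v y)) + y \<bullet> (A *\<^sub>v y)"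
  using assms symmetric_swap[OF assms] 
  by (simp add: mult_add_distrib_mat_vec[of _ n n] add_scalar_prod_distrib[of _ n]
      scalar_prod_add_distrib[of _ n])

lemma quad_diff:
  assumes "symmetric A" "A \<in> carrier_mat n n" "x \<in> carrier_vec n" "y \<in> carrier_vec n"
  shows "(x - y) \<bullet> (A *\<^sub>v (x - y)) = x \<bullet> (A *\<^sub>v x) - 2 * (x \<bullet> (A *\<^sub>v y)) + y \<bullet> (A *\<^sub>v y)"
  using assms symmetric_swap[OF assms] 
  by (simp add: mult_minus_distrib_mat_vec[of _ n n] minus_scalar_prod_distrib[of _ n]
      scalar_prod_minus_distrib[of _ n])

lemma pos_defD:
  assumes "pos_def A" "A \<in> carrier_mat n n"
  shows "symmetric A" "A\<^sup>T = A"
    and "\<And>v. v \<in> carrier_vec n \<Longrightarrow> v \<noteq> 0\<^sub>v n \<Longrightarrow> v \<bullet> (A *\<^sub>v v) > 0"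
    and "\<And>v. v \<in> carrier_vec n \<Longrightarrow> v \<bullet> (A *\<^sub>v v) \<ge> 0"
proof -
  show "symmetric A" "A\<^sup>T = A" using assms by (auto simp: pos_def_def symmetric_def)
  show *: "v \<bullet> (A *\<^sub>v v) > 0" if "v \<in> carrier_vec n" "v \<noteq> 0\<^sub>v n" for v
    using assms that by (auto simp: pos_def_def)
  show "v \<bullet> (A *\<^sub>v v) \<ge> 0" if "v \<in> carrier_vec n" for v
    using *[OF that] that assms(2) by (cases "v = 0\<^sub>v n") (auto simp: less_imp_le)
qed

text \<open>A definite form has no nonzero kernel vector, so the determinant is nonzero. For
  definiteness of the inverse put w = \<open>mat_inv A *\<^sub>v v\<close>: then v . w = w . A
  w.\<close>

lemma pos_def_inverse:
  assumes pd: "pos_def A" and A: "A \<in> carrier_mat n n"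
  shows "mat_inv A \<in> carrier_mat n n" "A * mat_inv A = 1\<^sub>m n" "mat_inv A * A = 1\<^sub>m n"
    and "pos_def (mat_inv A)"
    and "\<And>v. v \<in> carrier_vec n \<Longrightarrow> A *\<^sub>v (mat_inv A *\<^sub>v v) = v"
    and "\<And>v. v \<in> carrier_vec n \<Longrightarrow> mat_inv A *\<^sub>v (A *\<^sub>v v) = v"
proof -
  have "\<not> (\<exists>v. v \<in> carrier_vec n \<and> v \<noteq> 0\<^sub>v n \<and> A *\<^sub>v v = 0\<^sub>v n)"
    using pos_defD(3)[OF assms] by fastforce
  hence "det A \<noteq> 0" using det_0_iff_vec_prod_zero_field[OF A] by blast
  from det_non_zero_imp_unit[OF A this, of "()"] mat_inverse(1)[OF A, of "()"]
  obtain B where "mat_inverse A = Some B" by (cases "mat_inverse A") auto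
  with mat_inverse(2)[OF A this]
  show Bc: "mat_inv A \<in> carrier_mat n n" and AB: "A * mat_inv A = 1\<^sub>m n"
    and BA: "mat_inv A * A = 1\<^sub>m n" by auto
  let ?B = "mat_inv A"
  show 1: "A *\<^sub>v (?B *\<^sub>v v) = v" if "v \<in> carrier_vec n" for v
    using assoc_mult_mat_vec[OF A Bc that] AB that by simp
  show "?B *\<^sub>v (A *\<^sub>v v) = v" if "v \<in> carrier_vec n" for v
    using assoc_mult_mat_vec[OF Bc A that] BA that by simp
  have "(?B)\<^sup>T = (?B)\<^sup>T * (A * ?B)" using AB Bc by simp
  also have "\<dots> = (?B)\<^sup>T * A\<^sup>T * ?B"
    using A Bc pos_defD(2)[OF assms] by (simp add: assoc_mult_mat[of _ n n _ n _ n])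
  also have "\<dots> = (A * ?B)\<^sup>T * ?B" using transpose_mult[OF A Bc] by simp
  also have "\<dots> = ?B" using AB Bc by simp
  finally have "symmetric ?B" using Bc by (simp add: symmetric_carrier)
  moreover have "v \<bullet> (?B *\<^sub>v v) > 0" if v: "v \<in> carrier_vec n" "v \<noteq> 0\<^sub>v n" for v
  proof -
    have w: "?B *\<^sub>v v \<in> carrier_vec n" using Bc v by simp
    have "A *\<^sub>v 0\<^sub>v n = 0\<^sub>v n" using A by (auto simp: vec_eq_iff)
    hence "?B *\<^sub>v v \<noteq> 0\<^sub>v n" using 1[OF v(1)] v by auto
    from pos_defD(3)[OF assms w this] show ?thesis
      using 1[OF v(1)] comm_scalar_prod[OF v(1) w] by simp
  qed
  ultimately show "pos_def ?B" using Bc by (auto simp: pos_def_def)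
qed

section \<open>The spectral theorem and square roots\<close>

text \<open>The pair consists of the real and imaginary parts of a complex eigenvector. It keeps the
  later arguments real, in the spectral theorem as well as in the stability test.\<close>

lemma complex_spectrum_real_pair:
  assumes M: "M \<in> carrier_mat n n" and k: "k \<in> complex_spectrum M"
  obtains a b where "a \<in> carrier_vec n" "b \<in> carrier_vec n" "a \<noteq> 0\<^sub>v n \<or> b \<noteq> 0\<^sub>v n"
    "M *\<^sub>v a = Re k \<cdot>\<^sub>v a - Im k \<cdot>\<^sub>v b" "M *\<^sub>v b = Im k \<cdot>\<^sub>v a + Re k \<cdot>\<^sub>v b"
proof -
  let ?M = "map_mat complex_of_real M"
  from k obtain v where v: "v \<in> carrier_vec n" "v \<noteq> 0\<^sub>v n" "?M *\<^sub>v v = k \<cdot>\<^sub>v v"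
    using M by (auto simp: complex_spectrum_def spectrum_def eigenvalue_def eigenvector_def)
  have row: "row ?M i \<bullet> v = k * v $ i" if "i < n" for i
    using arg_cong[OF v(3), of "\<lambda>w. w $ i"] that M v(1) by simp
  let ?a = "map_vec Re v" and ?b = "map_vec Im v"
  have "Re (row ?M i \<bullet> v) = row M i \<bullet> ?a" "Im (row ?M i \<bullet> v) = row M i \<bullet> ?b" if "i < n" for i
    using that M v(1) by (auto simp: scalar_prod_def)
  hence re: "row M i \<bullet> ?a = Re (k * v $ i)" "row M i \<bullet> ?b = Im (k * v $ i)" if "i < n" for i
    using that row by auto
  show thesis
  proof (rule that[of ?a ?b])
    show "?a \<noteq> 0\<^sub>v n \<or> ?b \<noteq> 0\<^sub>v n"
    proof (rule ccontr)
      assume "\<not> ?thesis"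
      hence "\<forall>i<n. Re (v $ i) = 0 \<and> Im (v $ i) = 0" using v(1) by (auto simp: vec_eq_iff)
      hence "v = 0\<^sub>v n" using v(1) by (auto simp: vec_eq_iff complex_eq_iff)
      thus False using v(2) by simp
    qed
    show "M *\<^sub>v ?a = Re k \<cdot>\<^sub>v ?a - Im k \<cdot>\<^sub>v ?b" using M v(1) re by (intro eq_vecI) auto
    show "M *\<^sub>v ?b = Im k \<cdot>\<^sub>v ?a + Re k \<cdot>\<^sub>v ?b" using M v(1) re by (intro eq_vecI) auto
  qed (use v(1) in auto)
qed

text \<open>Symmetry equates a . Ab with b . Aa for the real pair (a, b) of an eigenvalue k. The
  difference is Im k (|a|^2 + |b|^2), so k is real and a nonzero one of a, b is an
  eigenvector.\<close>

lemma symmetric_has_unit_eigenvector: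
  assumes sym: "symmetric A" and A: "A \<in> carrier_mat n n" and n: "n > 0"
  obtains v \<mu> where "v \<in> carrier_vec n" "v \<bullet> v = 1" "A *\<^sub>v v = \<mu> \<cdot>\<^sub>v v"
proof -
  have "complex_spectrum A \<noteq> {}"
    unfolding complex_spectrum_def using A n by (intro spectrum_non_empty[of _ n]) auto
  then obtain k where "k \<in> complex_spectrum A" by auto
  from complex_spectrum_real_pair[OF A this] obtain a b where
    ab: "a \<in> carrier_vec n" "b \<in> carrier_vec n" "a \<noteq> 0\<^sub>v n \<or> b \<noteq> 0\<^sub>v n" and
    Aa: "A *\<^sub>v a = Re k \<cdot>\<^sub>v a - Im k \<cdot>\<^sub>v b" and Ab: "A *\<^sub>v b = Im k \<cdot>\<^sub>v a + Re k \<cdot>\<^sub>v b" .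
  have "a \<bullet> (A *\<^sub>v b) = b \<bullet> (A *\<^sub>v a)" by (rule symmetric_swap[OF sym A ab(1,2)])
  hence "Im k * (a \<bullet> a + b \<bullet> b) = 0"
    unfolding Aa Ab using ab comm_scalar_prod[OF ab(1,2)]
    by (simp add: scalar_prod_add_distrib[of _ n] scalar_prod_minus_distrib[of _ n] algebra_simps)
  moreover have "a \<bullet> a + b \<bullet> b > 0"
    using ab scalar_prod_self_pos[of a n] scalar_prod_self_pos[of b n]
      scalar_prod_self_nonneg[of a] scalar_prod_self_nonneg[of b] by fastforce
  ultimately have "Im k = 0" by auto
  hence "A *\<^sub>v a = Re k \<cdot>\<^sub>v a" "A *\<^sub>v b = Re k \<cdot>\<^sub>v b" using Aa Ab ab by auto
  then obtain c where c: "c \<in> carrier_vec n" "c \<noteq> 0\<^sub>v n" "A *\<^sub>v c = Re k \<cdot>\<^sub>v c" using ab by blast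
  let ?r = "1 / sqrt (c \<bullet> c)"
  have pos: "c \<bullet> c > 0" using scalar_prod_self_pos[OF c(1,2)] .
  show thesis
  proof (rule that[of "?r \<cdot>\<^sub>v c" "Re k"])
    show "(?r \<cdot>\<^sub>v c) \<bullet> (?r \<cdot>\<^sub>v c) = 1" using c pos by (simp add: field_simps)
    show "A *\<^sub>v (?r \<cdot>\<^sub>v c) = Re k \<cdot>\<^sub>v (?r \<cdot>\<^sub>v c)"
      using mult_mat_vec[OF A c(1)] c(3) by (simp add: smult_smult_assoc mult.commute)
  qed (use c in auto)
qed

text \<open>The Householder reflection exchanging \<open>e\<^sub>0\<close> and \<open>v\<close>.\<close>

lemma reflection_to_unit_vector:
  assumes v: "(v :: real vec) \<in> carrier_vec n" "v \<bullet> v = 1" and n: "n > 0"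
  obtains H where "H \<in> carrier_mat n n" "H\<^sup>T = H" "H * H = 1\<^sub>m n"
    "H *\<^sub>v unit_vec n 0 = v"
proof -
  let ?e = "unit_vec n 0 :: real vec"
  define w where "w = v - ?e"
  have w: "w \<in> carrier_vec n" using v by (simp add: w_def)
  show thesis
  proof (cases "w = 0\<^sub>v n")
    \<comment> \<open>The reflection divides by w . w, so the case v = ?e takes the identity
      instead.\<close>
    case True
    have "v = ?e"
    proof (rule eq_vecI)
      fix i assume "i < dim_vec ?e"
      thus "v $ i = ?e $ i" using arg_cong[OF True, of "\<lambda>u. u $ i"] v by (simp add: w_def)
    qed (use v in simp)
    thus thesis using that[of "1\<^sub>m n"] by simp
  next
    case False
    define c where "c = 2 / (w \<bullet> w)"
    have ww: "w \<bullet> w > 0" using scalar_prod_self_pos[OF w False] .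
    define H where "H = mat n n (\<lambda>(i, j). (if i = j then 1 else 0) - c * w $ i * w $ j)"
    have H: "H \<in> carrier_mat n n" by (simp add: H_def)
    have Hx: "H *\<^sub>v x = x - (c * (w \<bullet> x)) \<cdot>\<^sub>v w" if x: "x \<in> carrier_vec n" for x
    proof (rule eq_vecI)
      fix i assume "i < dim_vec (x - (c * (w \<bullet> x)) \<cdot>\<^sub>v w)"
      hence i: "i < n" using w by simp
      have "(H *\<^sub>v x) $ i = (\<Sum>j\<in>{0..<n}. (if i = j then x $ j else 0) - c * w $ i * (w $ j * x $ j))"
        using i x by (auto simp: H_def scalar_prod_def left_diff_distrib intro!: sum.cong)
      also have "\<dots> = x $ i - c * w $ i * (w \<bullet> x)"
        using i x by (simp add: sum_subtractf scalar_prod_def sum_distrib_left)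
      finally show "(H *\<^sub>v x) $ i = (x - (c * (w \<bullet> x)) \<cdot>\<^sub>v w) $ i"
        using i w x by (simp add: mult.commute mult.left_commute)
    qed (use H w in simp)
    show thesis
    proof (rule that[OF H])
      show "H\<^sup>T = H" by (rule eq_matI) (auto simp: H_def)
      show "H * H = 1\<^sub>m n"
      proof (rule mat_eqI_mult_vec[of _ n n])
        fix x :: "real vec" assume x: "x \<in> carrier_vec n"
        have "w \<bullet> (H *\<^sub>v x) = w \<bullet> x - c * (w \<bullet> x) * (w \<bullet> w)"
          unfolding Hx[OF x] using w x by (simp add: scalar_prod_minus_distrib[of _ n])
        also have "\<dots> = - (w \<bullet> x)" using ww by (simp add: c_def)
        finally have "H *\<^sub>v (H *\<^sub>v x) = H *\<^sub>v x - (c * - (w \<bullet> x)) \<cdot>\<^sub>v w"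
          using Hx[of "H *\<^sub>v x"] H x by simp
        also have "\<dots> = x" unfolding Hx[OF x] using w x by (intro eq_vecI) auto
        finally show "H * H *\<^sub>v x = 1\<^sub>m n *\<^sub>v x"
          using assoc_mult_mat_vec[OF H H x] x by simp
      qed (use H in auto)
      have ve: "v \<bullet> ?e = v $ 0" "?e \<bullet> v = v $ 0" "?e \<bullet> ?e = 1" using v n by auto
      \<comment> \<open>Both vectors have length 1, hence w . w = - 2 (w . ?e); the factor 2 in c
        then makes the reflection add exactly w to ?e.\<close>
      have "w \<bullet> ?e = v $ 0 - 1" "w \<bullet> w = 2 - 2 * v $ 0"
        unfolding w_def using v n ve
        by (simp_all add: minus_scalar_prod_distrib[of _ n] scalar_prod_minus_distrib[of _ n])
      hence "c * (w \<bullet> ?e) = -1" using ww by (simp add: c_def field_simps)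
      hence "H *\<^sub>v ?e = ?e + w" using Hx[of ?e] w by (intro eq_vecI) auto
      thus "H *\<^sub>v ?e = v" using v by (intro eq_vecI) (auto simp: w_def)
    qed
  qed
qed

text \<open>Deflation: conjugation by a symmetric involution H that sends the first unit vector to
  an eigenvector clears the first column up to its corner, and by symmetry the first row. A
  symmetric block of size one less remains, and the diagonalising matrix is H times the block
  extension of the smaller one.\<close>

theorem real_spectral_theorem:
  assumes "symmetric A" "A \<in> carrier_mat n n"
  shows "\<exists>U d. U \<in> carrier_mat n n \<and> U\<^sup>T * U = 1\<^sub>m n \<and> U * U\<^sup>T = 1\<^sub>m n \<and> A = U * mat_diag n d * U\<^sup>T"
  using assms
proof (induction n arbitrary: A)
  case 0
  show ?case
    by (rule exI[of _ "1\<^sub>m 0"], rule exI[of _ "\<lambda>_. 0"]) (use 0 in \<open>auto intro!: eq_matI\<close>)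
next
  case (Suc k A)
  note A = Suc.prems(2)
  let ?e = "unit_vec (Suc k) 0 :: real vec"
  obtain v \<mu> where v: "v \<in> carrier_vec (Suc k)" "v \<bullet> v = 1" and Av: "A *\<^sub>v v = \<mu> \<cdot>\<^sub>v v"
    using symmetric_has_unit_eigenvector[OF Suc.prems] by blast
  obtain H where H: "H \<in> carrier_mat (Suc k) (Suc k)" "H\<^sup>T = H" "H * H = 1\<^sub>m (Suc k)" "H *\<^sub>v ?e = v"
    using reflection_to_unit_vector[OF v] by blast
  have Hv: "H *\<^sub>v v = ?e"
    using assoc_mult_mat_vec[OF H(1) H(1), of ?e] H by simp
  define M where "M = H * A * H"
  have M: "M \<in> carrier_mat (Suc k) (Suc k)" using H A by (simp add: M_def)
  have "M\<^sup>T = H * (A * H)"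
    unfolding M_def using H A Suc.prems(1)
    by (simp add: transpose_mult[of _ "Suc k" "Suc k" _ "Suc k"] symmetric_carrier[OF A])
  hence Msym: "M\<^sup>T = M" unfolding M_def using H A assoc_mult_mat[of H "Suc k" "Suc k" A "Suc k" H "Suc k"] by simp
  have Me: "M *\<^sub>v ?e = \<mu> \<cdot>\<^sub>v ?e"
    unfolding M_def using H A v Av Hv
    by (simp add: assoc_mult_mat_vec[of _ "Suc k" "Suc k" _ "Suc k"] mult_mat_vec[of _ "Suc k" "Suc k"])
  have M0: "M $$ (i, 0) = (if i = 0 then \<mu> else 0)" if "i < Suc k" for i
    using arg_cong[OF Me, of "\<lambda>w. w $ i"] that M by simp
  have M0': "M $$ (0, i) = (if i = 0 then \<mu> else 0)" if "i < Suc k" for i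
    using M0[OF that] arg_cong[OF Msym, of "\<lambda>N. N $$ (0, i)"] that M by simp
  define L where "L = mat k k (\<lambda>(i, j). M $$ (Suc i, Suc j))"
  have L: "L \<in> carrier_mat k k" by (simp add: L_def)
  have "L\<^sup>T = L"
  proof (rule eq_matI)
    fix i j assume "i < dim_row L" "j < dim_col L"
    thus "L\<^sup>T $$ (i, j) = L $$ (i, j)"
      using arg_cong[OF Msym, of "\<lambda>N. N $$ (Suc i, Suc j)"] M by (simp add: L_def)
  qed (simp_all add: L_def)
  hence "symmetric L" using L by (simp add: symmetric_carrier)
  from Suc.IH[OF this L] obtain U d where U: "U \<in> carrier_mat k k"
    "U\<^sup>T * U = 1\<^sub>m k" "U * U\<^sup>T = 1\<^sub>m k" "L = U * mat_diag k d * U\<^sup>T" by blast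
  define V where "V = four_block_mat (1\<^sub>m 1) (0\<^sub>m 1 k) (0\<^sub>m k 1) U"
  \<comment> \<open>\<open>case_nat\<close> puts \<mu> at index 0 and shifts the eigenvalues of the
    smaller block by one.\<close>
  define D where "D = mat_diag (Suc k) (case_nat \<mu> d)"
  have V: "V \<in> carrier_mat (Suc k) (Suc k)"
    unfolding V_def using four_block_carrier_mat[of "1\<^sub>m 1" 1 1 U k k] U(1) by auto
  have VT: "V\<^sup>T = four_block_mat (1\<^sub>m 1) (0\<^sub>m 1 k) (0\<^sub>m k 1) (U\<^sup>T)"
    unfolding V_def using U(1) by (subst transpose_four_block_mat[of _ 1 1 _ k _ k]) auto
  have D_block: "D = four_block_mat (mat_diag 1 (\<lambda>_. \<mu>)) (0\<^sub>m 1 k) (0\<^sub>m k 1) (mat_diag k d)"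
    unfolding D_def mat_diag_def by (rule eq_matI) (auto split: nat.splits)
  have M_block: "M = four_block_mat (mat_diag 1 (\<lambda>_. \<mu>)) (0\<^sub>m 1 k) (0\<^sub>m k 1) L"
    using M M0 M0' by (intro eq_matI) (auto simp: L_def mat_diag_def)
  have one_block: "four_block_mat (1\<^sub>m 1) (0\<^sub>m 1 k) (0\<^sub>m k 1) (1\<^sub>m k) = (1\<^sub>m (Suc k) :: real mat)"
    by (rule eq_matI) auto
  have VTV: "V\<^sup>T * V = 1\<^sub>m (Suc k)"
    unfolding VT unfolding V_def using U(1,2)
    by (subst mult_four_block_mat[of _ 1 1 _ k _ k _ _ 1 _ k]) (auto simp: one_block)
  have VVT: "V * V\<^sup>T = 1\<^sub>m (Suc k)"
    unfolding VT unfolding V_def using U(1,3)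
    by (subst mult_four_block_mat[of _ 1 1 _ k _ k _ _ 1 _ k]) (auto simp: one_block)
  have VD: "V * D = four_block_mat (mat_diag 1 (\<lambda>_. \<mu>)) (0\<^sub>m 1 k) (0\<^sub>m k 1) (U * mat_diag k d)"
    unfolding V_def D_block using U(1)
    by (subst mult_four_block_mat[of _ 1 1 _ k _ k _ _ 1 _ k]) (auto simp: mat_diag_def)
  have VDV: "V * D * V\<^sup>T = M"
    unfolding VD unfolding VT M_block using U(1,4)
    by (subst mult_four_block_mat[of _ 1 1 _ k _ k _ _ 1 _ k])
       (auto simp: mat_diag_def mult_carrier_mat[of _ k k])
  have Dc: "D \<in> carrier_mat (Suc k) (Suc k)" by (simp add: D_def)
  note assoc = assoc_mult_mat[of _ "Suc k" "Suc k" _ "Suc k" _ "Suc k"]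
  have HVT: "(H * V)\<^sup>T = V\<^sup>T * H" using transpose_mult[OF H(1) V] H(2) by simp
  have "(H * V)\<^sup>T * (H * V) = V\<^sup>T * (H * H) * V" unfolding HVT using H(1) V by (simp add: assoc)
  also have "\<dots> = V\<^sup>T * 1\<^sub>m (Suc k) * V" by (simp only: H(3))
  also have "\<dots> = 1\<^sub>m (Suc k)" using V VTV by simp
  finally have 1: "(H * V)\<^sup>T * (H * V) = 1\<^sub>m (Suc k)" .
  have "(H * V) * (H * V)\<^sup>T = H * (V * V\<^sup>T) * H" unfolding HVT using H(1) V by (simp add: assoc)
  also have "\<dots> = 1\<^sub>m (Suc k)" using H(1,3) by (simp add: VVT)
  finally have 2: "(H * V) * (H * V)\<^sup>T = 1\<^sub>m (Suc k)" .
  have "(H * V) * D * (H * V)\<^sup>T = H * (V * D * V\<^sup>T) * H" unfolding HVT using H V Dc by (simp add: assoc)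
  also have "\<dots> = (H * H) * A * (H * H)" unfolding VDV M_def using H(1) A by (simp add: assoc)
  also have "\<dots> = A" using H A by simp
  finally show ?case using 1 2 H V D_def by (metis mult_carrier_mat)
qed

lemma mat_diag_mult_vec:
  assumes "x \<in> carrier_vec n"
  shows "mat_diag n f *\<^sub>v x = vec n (\<lambda>i. f i * x $ i :: real)"
proof (rule eq_vecI)
  fix i assume "i < dim_vec (vec n (\<lambda>i. f i * x $ i))"
  hence i: "i < n" by simp
  have "(mat_diag n f *\<^sub>v x) $ i = (\<Sum>j\<in>{0..<n}. (if i = j then f j else 0) * x $ j)"
    using i assms by (auto simp: mat_diag_def scalar_prod_def)
  also have "\<dots> = f i * x $ i" using i by (subst sum.remove[of _ i]) auto
  finally show "(mat_diag n f *\<^sub>v x) $ i = vec n (\<lambda>i. f i * x $ i) $ i" using i by simp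
qed (simp add: mat_diag_def)

lemma eigenvector_of_diagonalization:
  assumes U: "(U :: real mat) \<in> carrier_mat n n" "U\<^sup>T * U = 1\<^sub>m n" and A: "A = U * mat_diag n d * U\<^sup>T" and j: "j < n"
  shows "A *\<^sub>v (U *\<^sub>v unit_vec n j) = d j \<cdot>\<^sub>v (U *\<^sub>v unit_vec n j)"
    and "(U *\<^sub>v unit_vec n j) \<bullet> (U *\<^sub>v unit_vec n j) = 1"
proof -
  let ?e = "unit_vec n j :: real vec"
  have UU: "U\<^sup>T *\<^sub>v (U *\<^sub>v ?e) = ?e" using U assoc_mult_mat_vec[of "U\<^sup>T" n n U n ?e] by simp
  have "mat_diag n d *\<^sub>v ?e = d j \<cdot>\<^sub>v ?e"
    using j by (intro eq_vecI) (auto simp: mat_diag_def)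
  thus "A *\<^sub>v (U *\<^sub>v ?e) = d j \<cdot>\<^sub>v (U *\<^sub>v ?e)"
    unfolding A using U UU
    by (simp add: assoc_mult_mat_vec[of _ n n _ n] mult_mat_vec[of _ n n])
  show "(U *\<^sub>v ?e) \<bullet> (U *\<^sub>v ?e) = 1"
    using adjoint_right[of U n n ?e "U *\<^sub>v ?e"] UU U j by simp
qed

section \<open>Existence and uniqueness of the semidefinite square root\<close>

lemma pos_semidef_sqrt_exists:
  assumes "pos_semidef Q" and Q: "Q \<in> carrier_mat n n"
  obtains S where "S \<in> carrier_mat n n" "pos_semidef S" "S * S = Q"
proof -
  from assms have "symmetric Q" by (simp add: pos_semidef_def)
  from real_spectral_theorem[OF this Q] obtain U d where
    U: "U \<in> carrier_mat n n" "U\<^sup>T * U = 1\<^sub>m n" "U * U\<^sup>T = 1\<^sub>m n" and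
    QU: "Q = U * mat_diag n d * U\<^sup>T" by blast
  \<comment> \<open>Semidefiniteness is tested on the j-th column of U, a unit eigenvector for d
    j.\<close>
  have d: "d j \<ge> 0" if j: "j < n" for j
    using eigenvector_of_diagonalization[OF U(1,2) QU j] assms(1) Q U(1)
    by (auto simp: pos_semidef_def dest: bspec[of _ _ "U *\<^sub>v unit_vec n j"])
  define E where "E = mat_diag n (\<lambda>j. sqrt (d j))"
  define S where "S = U * E * U\<^sup>T"
  have E: "E \<in> carrier_mat n n" "E\<^sup>T = E" by (auto simp: E_def mat_diag_def)
  have S: "S \<in> carrier_mat n n" using U E by (simp add: S_def)
  note assoc = assoc_mult_mat[of _ n n _ n _ n]
  have "E * E = mat_diag n d" unfolding E_def
    by (subst mat_diag_mult_left[of _ n n]) (auto intro!: eq_matI simp: mat_diag_def d)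
  moreover have "S * S = U * (E * (U\<^sup>T * U) * E) * U\<^sup>T" unfolding S_def using U(1) E by (simp add: assoc)
  ultimately have SS: "S * S = Q" using U E QU by simp
  have "S\<^sup>T = S" unfolding S_def using U(1) E
    by (simp add: transpose_mult[of _ n n _ n] assoc)
  hence "symmetric S" using S by (simp add: symmetric_carrier)
  moreover have "v \<bullet> (S *\<^sub>v v) \<ge> 0" if v: "v \<in> carrier_vec n" for v
  proof -
    let ?w = "U\<^sup>T *\<^sub>v v"
    have w: "?w \<in> carrier_vec n" using U v by simp
    have "v \<bullet> (S *\<^sub>v v) = v \<bullet> (U *\<^sub>v (E *\<^sub>v ?w))"
      unfolding S_def using U(1) E v by (simp add: assoc_mult_mat_vec[of _ n n _ n])
    also have "\<dots> = ?w \<bullet> (E *\<^sub>v ?w)"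
      using transpose_vec_mult_scalar[OF U(1), of "E *\<^sub>v ?w" v] E w v by simp
    also have "\<dots> = (\<Sum>i\<in>{0..<n}. ?w $ i * (sqrt (d i) * ?w $ i))"
      unfolding E_def mat_diag_mult_vec[OF w] by (simp add: scalar_prod_def)
    also have "\<dots> \<ge> 0" using d by (intro sum_nonneg) (auto simp: mult.left_commute)
    finally show ?thesis .
  qed
  ultimately have "pos_semidef S" using S by (auto simp: pos_semidef_def)
  thus thesis using that S SS by blast
qed

text \<open>If \<open>(S - T)v = \<mu>v\<close> with \<open>\<mu> \<noteq> 0\<close>, then \<open>0 = v \<bullet> (S\<^sup>2 - T\<^sup>2)v = \<mu> v \<bullet> (S + T)v\<close>, so both
  \<open>v \<bullet> Sv\<close> and \<open>v \<bullet> Tv\<close> vanish, and hence so does \<open>v \<bullet> (S - T)v = \<mu> |v|\<^sup>2\<close>.\<close>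

lemma pos_semidef_sqrt_unique:
  assumes S: "S \<in> carrier_mat n n" "pos_semidef S" and T: "T \<in> carrier_mat n n" "pos_semidef T"
    and eq: "S * S = T * T"
  shows "S = T"
proof -
  have sS: "symmetric S" and sT: "symmetric T" using S T by (auto simp: pos_semidef_def)
  have DT: "(S - T)\<^sup>T = S - T"
    using sS sT S T by (intro eq_matI) (auto simp: symmetric_def; metis index_transpose_mat(1) carrier_matD)+
  have D: "S - T \<in> carrier_mat n n" using S T by auto
  from real_spectral_theorem[of "S - T" n] D DT obtain U d where
    U: "U \<in> carrier_mat n n" "U\<^sup>T * U = 1\<^sub>m n" "U * U\<^sup>T = 1\<^sub>m n" and
    DU: "S - T = U * mat_diag n d * U\<^sup>T" by (auto simp: symmetric_carrier)
  have "d j = 0" if j: "j < n" for j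
  proof (rule ccontr)
    assume nz: "d j \<noteq> 0"
    define v where "v = U *\<^sub>v unit_vec n j"
    have v: "v \<in> carrier_vec n" using U by (simp add: v_def)
    have vv: "v \<bullet> v = 1" and Dv: "(S - T) *\<^sub>v v = d j \<cdot>\<^sub>v v"
      using eigenvector_of_diagonalization[OF U(1,2) DU j] by (auto simp: v_def)
    have Svc: "S *\<^sub>v v \<in> carrier_vec n" and Tvc: "T *\<^sub>v v \<in> carrier_vec n" using S T v by auto
    have "S *\<^sub>v v - T *\<^sub>v v = d j \<cdot>\<^sub>v v"
      using Dv minus_mult_distrib_mat_vec[OF S(1) T(1) v] by simp
    hence Sv: "S *\<^sub>v v = T *\<^sub>v v + d j \<cdot>\<^sub>v v"
      using S(1) T(1) v by (auto simp: vec_eq_iff)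
    have "S *\<^sub>v (S *\<^sub>v v) = T *\<^sub>v (T *\<^sub>v v)"
      using assoc_mult_mat_vec[OF S(1) S(1) v] assoc_mult_mat_vec[OF T(1) T(1) v] eq by simp
    hence "v \<bullet> (S *\<^sub>v (S *\<^sub>v v)) = v \<bullet> (T *\<^sub>v (T *\<^sub>v v))" by simp
    hence "(S *\<^sub>v v) \<bullet> (S *\<^sub>v v) = (T *\<^sub>v v) \<bullet> (T *\<^sub>v v)"
      using symmetric_swap[OF sS S(1) v Svc] symmetric_swap[OF sT T(1) v Tvc] by simp
    hence "d j * (2 * ((T *\<^sub>v v) \<bullet> v) + d j) = 0"
      unfolding Sv using v Tvc vv by (simp add: scalar_prod_add_self[of _ n] algebra_simps)
    hence "2 * (v \<bullet> (T *\<^sub>v v)) + d j = 0" using nz comm_scalar_prod[OF v Tvc] by simp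
    moreover have "v \<bullet> (S *\<^sub>v v) = v \<bullet> (T *\<^sub>v v) + d j"
      unfolding Sv using v Tvc vv by (simp add: scalar_prod_add_distrib[of _ n])
    moreover have "v \<bullet> (S *\<^sub>v v) \<ge> 0" "v \<bullet> (T *\<^sub>v v) \<ge> 0"
      using S T v by (auto simp: pos_semidef_def)
    ultimately show False using nz by linarith
  qed
  hence "mat_diag n d = 0\<^sub>m n n" by (intro eq_matI) (auto simp: mat_diag_def)
  hence D0: "S - T = 0\<^sub>m n n" using DU U by simp
  show ?thesis
  proof (rule eq_matI)
    fix i j assume "i < dim_row T" "j < dim_col T"
    thus "S $$ (i, j) = T $$ (i, j)"
      using arg_cong[OF D0, of "\<lambda>N. N $$ (i, j)"] S T by simp
  qed (use S T in auto)
qed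

text \<open>\<open>psd_sqrt\<close> is a definite description, so none of its properties is
  available before existence and uniqueness are both known.\<close>

lemma psd_sqrt:
  assumes "pos_semidef Q" "Q \<in> carrier_mat n n"
  shows "psd_sqrt Q \<in> carrier_mat n n" "symmetric (psd_sqrt Q)" "psd_sqrt Q * psd_sqrt Q = Q"
proof -
  have "\<exists>!S. S \<in> carrier_mat n n \<and> pos_semidef S \<and> S * S = Q"
    by (rule pos_semidef_sqrt_exists[OF assms]) (metis pos_semidef_sqrt_unique)
  from theI'[OF this]
  show "psd_sqrt Q \<in> carrier_mat n n" "symmetric (psd_sqrt Q)" "psd_sqrt Q * psd_sqrt Q = Q"
    using assms(2) by (auto simp: psd_sqrt_def pos_semidef_def)
qed

lemma quad_psd_sqrt:
  assumes "pos_semidef Q" "Q \<in> carrier_mat n n" "v \<in> carrier_vec n"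
  shows "(psd_sqrt Q *\<^sub>v v) \<bullet> (psd_sqrt Q *\<^sub>v v) = v \<bullet> (Q *\<^sub>v v)"
proof -
  note S = psd_sqrt[OF assms(1,2)]
  have "v \<bullet> (Q *\<^sub>v v) = v \<bullet> (psd_sqrt Q *\<^sub>v (psd_sqrt Q *\<^sub>v v))"
    using assoc_mult_mat_vec[OF S(1) S(1) assms(3)] S(3) by simp
  thus ?thesis using symmetric_swap[OF S(2,1) assms(3), of "psd_sqrt Q *\<^sub>v v"] S(1) assms(3) by simp
qed

section \<open>Quadratic forms of block matrices\<close>

lemma mult_mat_zero_vec [simp]:
  assumes "(A :: real mat) \<in> carrier_mat nr nc"
  shows "A *\<^sub>v 0\<^sub>v nc = 0\<^sub>v nr"
  using assms by (auto simp: vec_eq_iff)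

lemma zero_mat_mult_vec [simp]:
  assumes "v \<in> carrier_vec nc"
  shows "0\<^sub>m nr nc *\<^sub>v v = (0\<^sub>v nr :: real vec)"
  using assms by (auto simp: vec_eq_iff)

lemma append_vec_assoc: "(x @\<^sub>v y) @\<^sub>v z = x @\<^sub>v (y @\<^sub>v z)"
  by (rule eq_vecI) auto

lemma zero_append_vec: "0\<^sub>v n @\<^sub>v 0\<^sub>v m = 0\<^sub>v (n + m)"
  by (rule eq_vecI) auto

lemma append_vec_eq_0_iff:
  assumes "x \<in> carrier_vec n" "y \<in> carrier_vec m"
  shows "x @\<^sub>v y = 0\<^sub>v (n + m) \<longleftrightarrow> x = 0\<^sub>v n \<and> y = 0\<^sub>v m"
  using append_vec_eq[of x n "0\<^sub>v n" y "0\<^sub>v m"] assms by (simp add: zero_append_vec)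

lemma quad_four_block:
  assumes "A \<in> carrier_mat p p" "B \<in> carrier_mat p q" "C \<in> carrier_mat q p" "D \<in> carrier_mat q q"
    and "x \<in> carrier_vec p" "y \<in> carrier_vec q"
  shows "(x @\<^sub>v y) \<bullet> (four_block_mat A B C D *\<^sub>v (x @\<^sub>v y))
    = x \<bullet> (A *\<^sub>v x) + x \<bullet> (B *\<^sub>v y) + y \<bullet> (C *\<^sub>v x) + y \<bullet> ((D :: real mat) *\<^sub>v y)"
  using assms
  by (simp add: four_block_mat_mult_vec[of _ p p _ q _ q] scalar_prod_append[of _ p _ q]
      scalar_prod_add_distrib[of _ p] scalar_prod_add_distrib[of _ q])

section \<open>Block matrices of arrow shape\<close>

context
  fixes n m s :: nat and X E Z G H W :: "real mat"
  assumes X: "X \<in> carrier_mat n n" and E: "E \<in> carrier_mat n n" and Z: "Z \<in> carrier_mat n n"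
    and G: "G \<in> carrier_mat s n" and H: "H \<in> carrier_mat m n" and W: "W \<in> carrier_mat m m"
begin

text \<open>The common shape of \<open>Phi1\<close>, \<open>Phi2\<close> and \<open>lmi_mat\<close>:
  off the diagonal only the first block row and column may be nonzero, so one computation of the
  quadratic form serves all three.\<close>

abbreviation (input) "arrow \<equiv> block4
   (- X) (E\<^sup>T)    (G\<^sup>T)    (H\<^sup>T)
   E     (- Z)    (0\<^sub>m n s) (0\<^sub>m n m)
   G     (0\<^sub>m s n) (- 1\<^sub>m s)  (0\<^sub>m s m)
   H     (0\<^sub>m m n) (0\<^sub>m m s) (- W)"

lemma arrow_carrier: "arrow \<in> carrier_mat (n + n + (s + m)) (n + n + (s + m))"
  unfolding block4_def using X Z W by (intro four_block_carrier_mat) auto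

lemma arrow_symmetric:
  assumes "symmetric X" "symmetric Z" "symmetric W"
  shows "symmetric arrow"
proof -
  have neg: "(- A)\<^sup>T = - A" if "symmetric A" for A :: "real mat"
  proof -
    have "(- A)\<^sup>T = - (A\<^sup>T)" by (rule eq_matI) auto
    thus ?thesis using that by (simp add: symmetric_def)
  qed
  have "arrow\<^sup>T = arrow"
    unfolding block4_def using X E Z G H W neg[OF assms(1)] neg[OF assms(2)] neg[OF assms(3)]
      neg[of "1\<^sub>m s"]
    by (simp add: transpose_four_block_mat[of _ "n + n" "n + n" _ "s + m" _ "s + m"]
        transpose_four_block_mat[of _ n n _ n _ n] transpose_four_block_mat[of _ n s _ m _ n]
        transpose_four_block_mat[of _ s n _ n _ m]
        transpose_four_block_mat[of _ s s _ m _ m] symmetric_def)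
  thus ?thesis using symmetric_carrier[OF arrow_carrier] by simp
qed

text \<open>Bracketing the vector like the nested \<open>four_block_mat\<close> calls of
  \<open>block4\<close> lets each quarter be evaluated by itself. A block and its transpose
  contribute the same scalar, hence the factors 2.\<close>

lemma arrow_quad:
  assumes v: "v1 \<in> carrier_vec n" "v2 \<in> carrier_vec n" "v3 \<in> carrier_vec s" "v4 \<in> carrier_vec m"
  shows "((v1 @\<^sub>v v2) @\<^sub>v (v3 @\<^sub>v v4)) \<bullet> (arrow *\<^sub>v ((v1 @\<^sub>v v2) @\<^sub>v (v3 @\<^sub>v v4)))
    = 2 * (v2 \<bullet> (E *\<^sub>v v1)) + 2 * (v3 \<bullet> (G *\<^sub>v v1)) + 2 * (v4 \<bullet> (H *\<^sub>v v1))
      - v1 \<bullet> (X *\<^sub>v v1) - v2 \<bullet> (Z *\<^sub>v v2) - v3 \<bullet> v3 - v4 \<bullet> (W *\<^sub>v v4)"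
proof -
  have c: "v1 @\<^sub>v v2 \<in> carrier_vec (n + n)" "v3 @\<^sub>v v4 \<in> carrier_vec (s + m)" using v by auto
  note quad1 = quad_four_block[of _ "n + n" _ "s + m", OF _ _ _ _ c]
  have 1: "(v1 @\<^sub>v v2) \<bullet> (four_block_mat (G\<^sup>T) (H\<^sup>T) (0\<^sub>m n s) (0\<^sub>m n m) *\<^sub>v (v3 @\<^sub>v v4))
     = v3 \<bullet> (G *\<^sub>v v1) + v4 \<bullet> (H *\<^sub>v v1)"
    using v G H
    by (simp add: four_block_mat_mult_vec[of _ n s _ m _ n] scalar_prod_append[of _ n _ n]
        scalar_prod_add_distrib[of _ n] adjoint_right[of _ _ n] mult_mat_vec_carrier[of _ n s]
        mult_mat_vec_carrier[of _ n m])
  have 2: "(v3 @\<^sub>v v4) \<bullet> (four_block_mat G (0\<^sub>m s n) H (0\<^sub>m m n) *\<^sub>v (v1 @\<^sub>v v2))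
     = v3 \<bullet> (G *\<^sub>v v1) + v4 \<bullet> (H *\<^sub>v v1)"
    using v G H
    by (simp add: four_block_mat_mult_vec[of _ s n _ n _ m] scalar_prod_append[of _ s _ m]
        scalar_prod_add_distrib[of _ s] scalar_prod_add_distrib[of _ m])
  have 3: "(v1 @\<^sub>v v2) \<bullet> (four_block_mat (- X) (E\<^sup>T) E (- Z) *\<^sub>v (v1 @\<^sub>v v2))
     = 2 * (v2 \<bullet> (E *\<^sub>v v1)) - v1 \<bullet> (X *\<^sub>v v1) - v2 \<bullet> (Z *\<^sub>v v2)"
    using v X E Z
    by (simp add: quad_four_block[of _ n _ n] adjoint_right[of _ n n])
  have 4: "(v3 @\<^sub>v v4) \<bullet> (four_block_mat (- 1\<^sub>m s) (0\<^sub>m s m) (0\<^sub>m m s) (- W) *\<^sub>v (v3 @\<^sub>v v4))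
     = - (v3 \<bullet> v3) - v4 \<bullet> (W *\<^sub>v v4)"
    using v W by (simp add: quad_four_block[of _ s _ m])
  show ?thesis
    unfolding block4_def
    by (subst quad1) (use X E Z G H W 1 2 3 4 in \<open>auto intro!: four_block_carrier_mat\<close>)
qed

end

lemma split4_vec:
  assumes "u \<in> carrier_vec (n + n + (s + m))"
  obtains v1 v2 v3 v4 where "v1 \<in> carrier_vec n" "v2 \<in> carrier_vec n" "v3 \<in> carrier_vec s"
    "v4 \<in> carrier_vec m" "u = (v1 @\<^sub>v v2) @\<^sub>v (v3 @\<^sub>v v4)"
proof -
  have "\<forall>u\<in>carrier_vec (n + n + (s + m)). \<exists>v1\<in>carrier_vec n. \<exists>v2\<in>carrier_vec n.
      \<exists>v3\<in>carrier_vec s. \<exists>v4\<in>carrier_vec m. u = (v1 @\<^sub>v v2) @\<^sub>v (v3 @\<^sub>v v4)"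
    unfolding all_vec_append by blast
  thus thesis using assms that by blast
qed

lemma append4_eq_0_iff:
  assumes "v1 \<in> carrier_vec n" "v2 \<in> carrier_vec n" "v3 \<in> carrier_vec s" "v4 \<in> carrier_vec m"
  shows "(v1 @\<^sub>v v2) @\<^sub>v (v3 @\<^sub>v v4) = 0\<^sub>v (n + n + (s + m)) \<longleftrightarrow>
    v1 = 0\<^sub>v n \<and> v2 = 0\<^sub>v n \<and> v3 = 0\<^sub>v s \<and> v4 = 0\<^sub>v m"
  using assms by (auto simp: append_vec_eq_0_iff)

section \<open>Null spaces of the block rows\<close>

lemma append_cols_mult_vec:
  assumes "M \<in> carrier_mat r p" "M' \<in> carrier_mat r q" "x \<in> carrier_vec p" "y \<in> carrier_vec q"
  shows "(M @\<^sub>c M') *\<^sub>v (x @\<^sub>v y) = M *\<^sub>v x + M' *\<^sub>v y"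
proof -
  \<comment> \<open>The bottom blocks of \<open>append_cols\<close> have no rows, so the product
    carries a trailing vector of length 0.\<close>
  have "(M @\<^sub>c M') *\<^sub>v (x @\<^sub>v y) = (M *\<^sub>v x + M' *\<^sub>v y) @\<^sub>v (0\<^sub>v 0 + 0\<^sub>v 0)"
    unfolding append_cols_def using assms
    by (simp add: four_block_mat_mult_vec[of _ r p _ q _ 0])
  thus ?thesis by auto
qed

lemma append_cols_carrier:
  assumes "M \<in> carrier_mat r p" "M' \<in> carrier_mat r q"
  shows "M @\<^sub>c M' \<in> carrier_mat r (p + q)"
  using assms by (auto simp: append_cols_def)

lemma C_tilde_carrier:
  assumes "C \<in> carrier_mat s n"
  shows "C_tilde n m s C \<in> carrier_mat s (n + n + (s + m))"
  unfolding C_tilde_def add.assoc using assms by (intro append_cols_carrier) auto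

lemma B_tilde_carrier:
  assumes "B \<in> carrier_mat n m"
  shows "B_tilde n m s B \<in> carrier_mat m (n + n + (s + m))"
  unfolding B_tilde_def add.assoc using assms by (intro append_cols_carrier) auto

lemma C_tilde_mult_vec:
  assumes "C \<in> carrier_mat s n"
    and v: "v1 \<in> carrier_vec n" "v2 \<in> carrier_vec n" "v3 \<in> carrier_vec s" "v4 \<in> carrier_vec m"
  shows "C_tilde n m s C *\<^sub>v ((v1 @\<^sub>v v2) @\<^sub>v (v3 @\<^sub>v v4)) = C *\<^sub>v v1"
  unfolding C_tilde_def append_vec_assoc using assms
  by (simp add: append_cols_mult_vec[of _ s n _ "n + (s + m)"] append_cols_mult_vec[of _ s n _ "s + m"]
      append_cols_mult_vec[of _ s s _ m] append_cols_carrier)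

text \<open>On the null space the fourth block is v4 = - B^T v2. \<open>Phi2\<close> does not
  mention B; the input matrix enters the second inequality through this coupling alone.\<close>

lemma B_tilde_mult_vec:
  assumes "B \<in> carrier_mat n m"
    and v: "v1 \<in> carrier_vec n" "v2 \<in> carrier_vec n" "v3 \<in> carrier_vec s" "v4 \<in> carrier_vec m"
  shows "B_tilde n m s B *\<^sub>v ((v1 @\<^sub>v v2) @\<^sub>v (v3 @\<^sub>v v4)) = B\<^sup>T *\<^sub>v v2 + v4"
  unfolding B_tilde_def append_vec_assoc using assms
  by (simp add: append_cols_mult_vec[of _ m n _ "n + (s + m)"] append_cols_mult_vec[of _ m n _ "s + m"]
      append_cols_mult_vec[of _ m s _ m] append_cols_carrier mult_mat_vec_carrier[of _ m n])

text \<open>Orthonormality makes w -> N w a bijection from coordinates onto the null space, with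
  inverse N^T, and the congruence transports the form along it. The condition is thereby freed from
  the chosen basis.\<close>

lemma neg_def_kernel_basis_iff:
  assumes N: "orthonormal_kernel_basis N M" and M: "M \<in> carrier_mat r p"
    and \<Phi>: "\<Phi> \<in> carrier_mat p p" "symmetric \<Phi>"
  shows "neg_def (N\<^sup>T * \<Phi> * N) \<longleftrightarrow>
    (\<forall>u\<in>carrier_vec p. u \<noteq> 0\<^sub>v p \<longrightarrow> M *\<^sub>v u = 0\<^sub>v r \<longrightarrow> u \<bullet> (\<Phi> *\<^sub>v u) < 0)"
proof -
  define d where "d = dim_col N"
  have Nc: "N \<in> carrier_mat p d" and NN: "N\<^sup>T * N = 1\<^sub>m d"
    and cs: "vec_space.col_space p N = mat_kernel M"
    using N M by (auto simp: orthonormal_kernel_basis_def d_def)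
  have range: "(\<exists>w\<in>carrier_vec d. N *\<^sub>v w = u) \<longleftrightarrow> M *\<^sub>v u = 0\<^sub>v r" if "u \<in> carrier_vec p" for u
    using vec_space.col_space_eq[OF Nc] cs that Nc M by (auto simp: mat_kernel_def)
  have inj: "N\<^sup>T *\<^sub>v (N *\<^sub>v w) = w" if "w \<in> carrier_vec d" for w
    using assoc_mult_mat_vec[of "N\<^sup>T" d p N d w] Nc NN that by simp
  have c: "N\<^sup>T * \<Phi> * N \<in> carrier_mat d d" using Nc \<Phi> by simp
  have "(N\<^sup>T * \<Phi> * N)\<^sup>T = N\<^sup>T * (\<Phi> * N)"
    using Nc \<Phi> transpose_mult[of "N\<^sup>T * \<Phi>" d p N d] transpose_mult[of "N\<^sup>T" d p \<Phi> p]
    by (simp del: assoc_mult_mat add: symmetric_def)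
  also have "\<dots> = N\<^sup>T * \<Phi> * N" using Nc \<Phi> by (simp add: assoc_mult_mat[of _ d p _ p _ d])
  finally have sym: "symmetric (N\<^sup>T * \<Phi> * N)" using symmetric_carrier[OF c] by simp
  have quad: "w \<bullet> ((N\<^sup>T * \<Phi> * N) *\<^sub>v w) = (N *\<^sub>v w) \<bullet> (\<Phi> *\<^sub>v (N *\<^sub>v w))" if w: "w \<in> carrier_vec d" for w
  proof -
    have "(N\<^sup>T * \<Phi> * N) *\<^sub>v w = N\<^sup>T *\<^sub>v (\<Phi> *\<^sub>v (N *\<^sub>v w))"
      using Nc \<Phi> w by (simp add: assoc_mult_mat_vec[of _ d p _ d] assoc_mult_mat_vec[of _ d p _ p])
    moreover have y: "\<Phi> *\<^sub>v (N *\<^sub>v w) \<in> carrier_vec p" "N *\<^sub>v w \<in> carrier_vec p" using Nc \<Phi> w by auto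
    ultimately show ?thesis
      using adjoint_right[OF Nc w y(1)] comm_scalar_prod[OF y] by simp
  qed
  have nz: "N *\<^sub>v w = 0\<^sub>v p \<longleftrightarrow> w = 0\<^sub>v d" if "w \<in> carrier_vec d" for w
    using inj[OF that] Nc by (metis mult_mat_zero_vec transpose_carrier_mat)
  have "neg_def (N\<^sup>T * \<Phi> * N) \<longleftrightarrow>
     (\<forall>w\<in>carrier_vec d. N *\<^sub>v w \<noteq> 0\<^sub>v p \<longrightarrow> (N *\<^sub>v w) \<bullet> (\<Phi> *\<^sub>v (N *\<^sub>v w)) < 0)"
    unfolding neg_def_def using sym c quad nz by (simp add: d_def[symmetric])
  also have "\<dots> \<longleftrightarrow> (\<forall>u\<in>carrier_vec p. u \<noteq> 0\<^sub>v p \<longrightarrow> M *\<^sub>v u = 0\<^sub>v r \<longrightarrow> u \<bullet> (\<Phi> *\<^sub>v u) < 0)"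
    using range Nc by (metis mult_mat_vec_carrier)
  finally show ?thesis .
qed

section \<open>The matrix inequalities as conditions on the state space\<close>

lemma scalar_prod_diff_self:
  assumes "(x :: real vec) \<in> carrier_vec n" "y \<in> carrier_vec n"
  shows "(x - y) \<bullet> (x - y) = x \<bullet> x - 2 * (x \<bullet> y) + y \<bullet> y"
  using assms comm_scalar_prod[OF assms]
  by (simp add: minus_scalar_prod_distrib[of _ n] scalar_prod_minus_distrib[of _ n])

definition closed_loop_form :: "real mat \<Rightarrow> real mat \<Rightarrow> real mat \<Rightarrow> real mat \<Rightarrow> real mat \<Rightarrow> real mat \<Rightarrow> real mat \<Rightarrow>
    real vec \<Rightarrow> real" where
  "closed_loop_form A B C Q R P L v =
     ((A + B * L) *\<^sub>v v) \<bullet> (P *\<^sub>v ((A + B * L) *\<^sub>v v)) - v \<bullet> (P *\<^sub>v v)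
     + (C *\<^sub>v v) \<bullet> (Q *\<^sub>v (C *\<^sub>v v)) + (L *\<^sub>v v) \<bullet> (R *\<^sub>v (L *\<^sub>v v))"

context
  fixes n m s :: nat and A C Q R P :: "real mat"
  assumes A: "A \<in> carrier_mat n n" and C: "C \<in> carrier_mat s n"
    and Q: "Q \<in> carrier_mat s s" "pos_semidef Q" and R: "R \<in> carrier_mat m m" "pos_def R"
    and P: "P \<in> carrier_mat n n" "pos_def P"
begin

private lemma SC: "psd_sqrt Q * C \<in> carrier_mat s n"
  using psd_sqrt(1)[OF Q(2,1)] C by simp

private lemma SC_norm:
  assumes "v \<in> carrier_vec n"
  shows "((psd_sqrt Q * C) *\<^sub>v v) \<bullet> ((psd_sqrt Q * C) *\<^sub>v v) = (C *\<^sub>v v) \<bullet> (Q *\<^sub>v (C *\<^sub>v v))"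
  using quad_psd_sqrt[OF Q(2,1), of "C *\<^sub>v v"] C assms
    assoc_mult_mat_vec[OF psd_sqrt(1)[OF Q(2,1)] C assms] by simp

private lemma P_sym: "P\<^sup>T = P" "symmetric P"
  using pos_defD[OF P(2,1)] by auto

private lemmas P_nonneg = pos_defD(4)[OF P(2,1)]
private lemmas P_pos = pos_defD(3)[OF P(2,1)]
private lemmas Ri = pos_def_inverse[OF R(2,1)]
private lemmas Ri_nonneg = pos_defD(4)[OF Ri(4,1)]
private lemmas Ri_pos = pos_defD(3)[OF Ri(4,1)]
private lemmas Pi = pos_def_inverse[OF P(2,1)]
private lemmas Pi_nonneg = pos_defD(4)[OF Pi(4,1)]
private lemmas Pi_pos = pos_defD(3)[OF Pi(4,1)]

text \<open>Squares are completed in v2 with weight P and in v3 with weight 1; the part that depends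
  on v1 alone is the closed-loop form of the zero gain.\<close>

lemma Phi1_properties:
  shows "Phi1 n m s A C Q R P \<in> carrier_mat (n + n + (s + m)) (n + n + (s + m))"
    and "symmetric (Phi1 n m s A C Q R P)"
    and "\<And>v1 v2 v3 v4. v1 \<in> carrier_vec n \<Longrightarrow> v2 \<in> carrier_vec n \<Longrightarrow> v3 \<in> carrier_vec s \<Longrightarrow>
      v4 \<in> carrier_vec m \<Longrightarrow>
      ((v1 @\<^sub>v v2) @\<^sub>v (v3 @\<^sub>v v4)) \<bullet> (Phi1 n m s A C Q R P *\<^sub>v ((v1 @\<^sub>v v2) @\<^sub>v (v3 @\<^sub>v v4)))
      = (A *\<^sub>v v1) \<bullet> (P *\<^sub>v (A *\<^sub>v v1)) - v1 \<bullet> (P *\<^sub>v v1) + (C *\<^sub>v v1) \<bullet> (Q *\<^sub>v (C *\<^sub>v v1))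
        - (v2 - A *\<^sub>v v1) \<bullet> (P *\<^sub>v (v2 - A *\<^sub>v v1))
        - (v3 - (psd_sqrt Q * C) *\<^sub>v v1) \<bullet> (v3 - (psd_sqrt Q * C) *\<^sub>v v1)
        - v4 \<bullet> (mat_inv R *\<^sub>v v4)"
proof -
  have PA: "P * A \<in> carrier_mat n n" using P A by simp
  have H: "0\<^sub>m m n \<in> carrier_mat m n" by simp
  have eq: "Phi1 n m s A C Q R P = block4
     (- P) ((P * A)\<^sup>T) ((psd_sqrt Q * C)\<^sup>T) ((0\<^sub>m m n)\<^sup>T)
     (P * A) (- P) (0\<^sub>m n s) (0\<^sub>m n m)
     (psd_sqrt Q * C) (0\<^sub>m s n) (- 1\<^sub>m s) (0\<^sub>m s m)
     (0\<^sub>m m n) (0\<^sub>m m n) (0\<^sub>m m s) (- mat_inv R)"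
    unfolding Phi1_def using transpose_mult[OF P(1) A] P_sym by simp
  note arrow = P(1) PA P(1) SC H Ri(1)
  show "Phi1 n m s A C Q R P \<in> carrier_mat (n + n + (s + m)) (n + n + (s + m))"
    unfolding eq by (rule arrow_carrier[OF arrow])
  show "symmetric (Phi1 n m s A C Q R P)"
    unfolding eq by (rule arrow_symmetric[OF arrow]) (use P_sym pos_defD(1)[OF Ri(4,1)] in auto)
  fix v1 v2 v3 v4 :: "real vec"
  assume v: "v1 \<in> carrier_vec n" "v2 \<in> carrier_vec n" "v3 \<in> carrier_vec s" "v4 \<in> carrier_vec m"
  have Av: "A *\<^sub>v v1 \<in> carrier_vec n" and Sv: "(psd_sqrt Q * C) *\<^sub>v v1 \<in> carrier_vec s"
    using A SC v by auto
  show "((v1 @\<^sub>v v2) @\<^sub>v (v3 @\<^sub>v v4)) \<bullet> (Phi1 n m s A C Q R P *\<^sub>v ((v1 @\<^sub>v v2) @\<^sub>v (v3 @\<^sub>v v4)))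
      = (A *\<^sub>v v1) \<bullet> (P *\<^sub>v (A *\<^sub>v v1)) - v1 \<bullet> (P *\<^sub>v v1) + (C *\<^sub>v v1) \<bullet> (Q *\<^sub>v (C *\<^sub>v v1))
        - (v2 - A *\<^sub>v v1) \<bullet> (P *\<^sub>v (v2 - A *\<^sub>v v1))
        - (v3 - (psd_sqrt Q * C) *\<^sub>v v1) \<bullet> (v3 - (psd_sqrt Q * C) *\<^sub>v v1)
        - v4 \<bullet> (mat_inv R *\<^sub>v v4)"
    unfolding eq arrow_quad[OF arrow v] quad_diff[OF P_sym(2) P(1) v(2) Av]
      scalar_prod_diff_self[OF v(3) Sv] SC_norm[OF v(1)] assoc_mult_mat_vec[OF P(1) A v(1)]
    using v by simp
qed

lemma set_X_iff:
  assumes NC: "orthonormal_kernel_basis NC (C_tilde n m s C)"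
  shows "P \<in> set_X n m s A C Q R NC \<longleftrightarrow>
    (\<forall>v\<in>carrier_vec n. v \<noteq> 0\<^sub>v n \<longrightarrow> C *\<^sub>v v = 0\<^sub>v s \<longrightarrow>
       (A *\<^sub>v v) \<bullet> (P *\<^sub>v (A *\<^sub>v v)) < v \<bullet> (P *\<^sub>v v))"
    (is "_ \<longleftrightarrow> ?cond")
proof -
  let ?\<Phi> = "Phi1 n m s A C Q R P"
  let ?p = "n + n + (s + m)"
  note quad = Phi1_properties(3)
  have "P \<in> set_X n m s A C Q R NC \<longleftrightarrow>
      (\<forall>u\<in>carrier_vec ?p. u \<noteq> 0\<^sub>v ?p \<longrightarrow> C_tilde n m s C *\<^sub>v u = 0\<^sub>v s \<longrightarrow> u \<bullet> (?\<Phi> *\<^sub>v u) < 0)"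
    using neg_def_kernel_basis_iff[OF NC C_tilde_carrier[OF C] Phi1_properties(1,2)] P
    by (simp add: set_X_def)
  also have "\<dots> \<longleftrightarrow> ?cond"
  proof (intro iffI ballI impI)
    fix v assume neg: "\<forall>u\<in>carrier_vec ?p. u \<noteq> 0\<^sub>v ?p \<longrightarrow> C_tilde n m s C *\<^sub>v u = 0\<^sub>v s \<longrightarrow> u \<bullet> (?\<Phi> *\<^sub>v u) < 0"
      and v: "v \<in> carrier_vec n" "v \<noteq> 0\<^sub>v n" "C *\<^sub>v v = 0\<^sub>v s"
    have c: "A *\<^sub>v v \<in> carrier_vec n" "(psd_sqrt Q * C) *\<^sub>v v \<in> carrier_vec s" "0\<^sub>v m \<in> carrier_vec m"
      using A SC v by auto
    \<comment> \<open>The point over v where all three squares vanish; it lies in the null space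
      because \<open>C_tilde\<close> constrains only the first block.\<close>
    let ?u = "(v @\<^sub>v A *\<^sub>v v) @\<^sub>v ((psd_sqrt Q * C) *\<^sub>v v @\<^sub>v 0\<^sub>v m)"
    have "?u \<bullet> (?\<Phi> *\<^sub>v ?u) < 0"
      using neg v c C_tilde_mult_vec[OF C v(1) c] append4_eq_0_iff[OF v(1) c]
      by (auto dest!: bspec[of _ _ ?u])
    thus "(A *\<^sub>v v) \<bullet> (P *\<^sub>v (A *\<^sub>v v)) < v \<bullet> (P *\<^sub>v v)"
      unfolding quad[OF v(1) c] using c v P Q Ri by simp
  next
    fix u assume cond: ?cond
      and u: "u \<in> carrier_vec ?p" "u \<noteq> 0\<^sub>v ?p" "C_tilde n m s C *\<^sub>v u = 0\<^sub>v s"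
    from u(1) obtain v1 v2 v3 v4 where
      v: "v1 \<in> carrier_vec n" "v2 \<in> carrier_vec n" "v3 \<in> carrier_vec s" "v4 \<in> carrier_vec m"
      and u_eq: "u = (v1 @\<^sub>v v2) @\<^sub>v (v3 @\<^sub>v v4)" by (rule split4_vec)
    have Cv: "C *\<^sub>v v1 = 0\<^sub>v s" using u(3) C_tilde_mult_vec[OF C v] u_eq by simp
    have c: "v2 - A *\<^sub>v v1 \<in> carrier_vec n" "v3 - (psd_sqrt Q * C) *\<^sub>v v1 \<in> carrier_vec s"
      using A SC v by auto
    note nn = P_nonneg[OF c(1)] scalar_prod_self_nonneg[of "v3 - (psd_sqrt Q * C) *\<^sub>v v1"] Ri_nonneg[OF v(4)]
    show "u \<bullet> (?\<Phi> *\<^sub>v u) < 0"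
    proof (cases "v1 = 0\<^sub>v n")
      case False
      hence "(A *\<^sub>v v1) \<bullet> (P *\<^sub>v (A *\<^sub>v v1)) < v1 \<bullet> (P *\<^sub>v v1)" using cond v Cv by blast
      thus ?thesis unfolding u_eq quad[OF v] using nn Cv Q by simp
    next
      \<comment> \<open>With v1 = 0 the form is minus the squares alone. The weights P, 1 and
        \<open>mat_inv R\<close> are all definite, so one nonzero block suffices.\<close>
      case True
      hence nz: "v2 \<noteq> 0\<^sub>v n \<or> v3 \<noteq> 0\<^sub>v s \<or> v4 \<noteq> 0\<^sub>v m"
        using u(2) append4_eq_0_iff[OF v] u_eq by auto
      have d: "v2 - A *\<^sub>v v1 = v2" "v3 - (psd_sqrt Q * C) *\<^sub>v v1 = v3"
        using v unfolding True mult_mat_zero_vec[OF A] mult_mat_zero_vec[OF SC] by auto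
      have h: "(A *\<^sub>v v1) \<bullet> (P *\<^sub>v (A *\<^sub>v v1)) = 0" "v1 \<bullet> (P *\<^sub>v v1) = 0" "(C *\<^sub>v v1) \<bullet> (Q *\<^sub>v (C *\<^sub>v v1)) = 0"
        using True A P Cv Q by simp_all
      show ?thesis
        unfolding u_eq quad[OF v] d h
        using nz nn[unfolded d] P_pos[OF v(2)] scalar_prod_self_pos[OF v(3)] Ri_pos[OF v(4)] by auto
    qed
  qed
  finally show ?thesis .
qed

section \<open>Inequalities that involve the input matrix\<close>

context
  fixes B :: "real mat"
  assumes B: "B \<in> carrier_mat n m"
begin

text \<open>Squares are completed in v2, v3 and v4 at once; |T v1|^2 is the input cost because the
  square root of R squares to R. The squares give strictness when v1 = 0.\<close>

lemma lmi_neg_def: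
  assumes K: "K \<in> carrier_mat m s"
    and neg: "\<And>v. v \<in> carrier_vec n \<Longrightarrow> v \<noteq> 0\<^sub>v n \<Longrightarrow> closed_loop_form A B C Q R P (K * C) v < 0"
  shows "neg_def (lmi_mat n m s A B C Q R P K)"
proof -
  let ?p = "n + n + (s + m)"
  let ?\<Phi> = "lmi_mat n m s A B C Q R P K"
  define M where "M = A + B * (K * C)"
  define T where "T = psd_sqrt R * (K * C)"
  have R': "pos_semidef R" using R pos_defD(1,4)[OF R(2,1)] by (auto simp: pos_semidef_def)
  note sR = psd_sqrt[OF R' R(1)]
  have M: "M \<in> carrier_mat n n" and T: "T \<in> carrier_mat m n"
    using A B C K sR by (auto simp: M_def T_def)
  have M_eq: "A + B * K * C = M" and T_eq: "psd_sqrt R * K * C = T"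
    using A B C K sR by (simp_all add: M_def T_def)
  have PM: "P * M \<in> carrier_mat n n" using P M by simp
  have eq: "?\<Phi> = block4
     (- P) ((P * M)\<^sup>T) ((psd_sqrt Q * C)\<^sup>T) (T\<^sup>T)
     (P * M) (- P) (0\<^sub>m n s) (0\<^sub>m n m)
     (psd_sqrt Q * C) (0\<^sub>m s n) (- 1\<^sub>m s) (0\<^sub>m s m)
     T (0\<^sub>m m n) (0\<^sub>m m s) (- 1\<^sub>m m)"
    unfolding lmi_mat_def M_eq T_eq using transpose_mult[OF P(1) M] P_sym by simp
  note arrow = P(1) PM P(1) SC T one_carrier_mat[of m]
  have c: "?\<Phi> \<in> carrier_mat ?p ?p" unfolding eq by (rule arrow_carrier[OF arrow])
  have sym: "symmetric ?\<Phi>"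
    unfolding eq by (rule arrow_symmetric[OF arrow]) (use P_sym in \<open>auto simp: symmetric_def\<close>)
  have "u \<bullet> (?\<Phi> *\<^sub>v u) < 0" if u: "u \<in> carrier_vec ?p" "u \<noteq> 0\<^sub>v ?p" for u
  proof -
    from u(1) obtain v1 v2 v3 v4 where
      v: "v1 \<in> carrier_vec n" "v2 \<in> carrier_vec n" "v3 \<in> carrier_vec s" "v4 \<in> carrier_vec m"
      and u_eq: "u = (v1 @\<^sub>v v2) @\<^sub>v (v3 @\<^sub>v v4)" by (rule split4_vec)
    have Mv: "M *\<^sub>v v1 \<in> carrier_vec n" and Sv: "(psd_sqrt Q * C) *\<^sub>v v1 \<in> carrier_vec s"
      and Tv: "T *\<^sub>v v1 \<in> carrier_vec m"
      using M SC T v by auto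
    have "(T *\<^sub>v v1) \<bullet> (T *\<^sub>v v1) = ((K * C) *\<^sub>v v1) \<bullet> (R *\<^sub>v ((K * C) *\<^sub>v v1))"
      unfolding T_def using quad_psd_sqrt[OF R' R(1), of "(K * C) *\<^sub>v v1"] K C v
        assoc_mult_mat_vec[OF sR(1), of "K * C" n v1] by simp
    hence quad: "u \<bullet> (?\<Phi> *\<^sub>v u) = closed_loop_form A B C Q R P (K * C) v1
        - (v2 - M *\<^sub>v v1) \<bullet> (P *\<^sub>v (v2 - M *\<^sub>v v1))
        - (v3 - (psd_sqrt Q * C) *\<^sub>v v1) \<bullet> (v3 - (psd_sqrt Q * C) *\<^sub>v v1)
        - (v4 - T *\<^sub>v v1) \<bullet> (v4 - T *\<^sub>v v1)"
      unfolding u_eq eq arrow_quad[OF arrow v] quad_diff[OF P_sym(2) P(1) v(2) Mv]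
        scalar_prod_diff_self[OF v(3) Sv] scalar_prod_diff_self[OF v(4) Tv]
        SC_norm[OF v(1)] assoc_mult_mat_vec[OF P(1) M v(1)] closed_loop_form_def M_def[symmetric]
      using v by simp
    have c: "v2 - M *\<^sub>v v1 \<in> carrier_vec n" using M v by auto
    note nn = P_nonneg[OF c] scalar_prod_self_nonneg[of "v3 - (psd_sqrt Q * C) *\<^sub>v v1"]
      scalar_prod_self_nonneg[of "v4 - T *\<^sub>v v1"]
    show ?thesis
    proof (cases "v1 = 0\<^sub>v n")
      case False
      thus ?thesis unfolding quad using nn neg[OF v(1)] by simp
    next
      case True
      hence nz: "v2 \<noteq> 0\<^sub>v n \<or> v3 \<noteq> 0\<^sub>v s \<or> v4 \<noteq> 0\<^sub>v m"
        using u(2) append4_eq_0_iff[OF v] u_eq by auto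
      have d: "v2 - M *\<^sub>v v1 = v2" "v3 - (psd_sqrt Q * C) *\<^sub>v v1 = v3" "v4 - T *\<^sub>v v1 = v4"
        using v unfolding True mult_mat_zero_vec[OF M] mult_mat_zero_vec[OF SC] mult_mat_zero_vec[OF T]
        by auto
      have KC: "K * C \<in> carrier_mat m n" using K C by simp
      have h: "closed_loop_form A B C Q R P (K * C) v1 = 0"
        unfolding closed_loop_form_def M_def[symmetric] True mult_mat_zero_vec[OF M] mult_mat_zero_vec[OF C]
          mult_mat_zero_vec[OF KC] mult_mat_zero_vec[OF P(1)] mult_mat_zero_vec[OF Q(1)]
          mult_mat_zero_vec[OF R(1)] by simp
      show ?thesis
        unfolding quad d h
        using nz nn[unfolded d] P_pos[OF v(2)] scalar_prod_self_pos[OF v(3)]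
          scalar_prod_self_pos[OF v(4)] by auto
    qed
  qed
  thus ?thesis using c sym by (auto simp: neg_def_def)
qed

text \<open>The substitution v1 = P u absorbs the inverse in the first block column. L is absent
  from the left side: on the null space it can be introduced freely, after which squares are
  completed with weights \<open>mat_inv P\<close>, 1 and \<open>mat_inv R\<close>.\<close>

lemma Phi2_properties:
  shows "Phi2 n m s A C Q R (mat_inv P) \<in> carrier_mat (n + n + (s + m)) (n + n + (s + m))"
    and "symmetric (Phi2 n m s A C Q R (mat_inv P))"
    and "\<And>u v2 v3 v4 L. u \<in> carrier_vec n \<Longrightarrow> v2 \<in> carrier_vec n \<Longrightarrow> v3 \<in> carrier_vec s \<Longrightarrow>
      v4 \<in> carrier_vec m \<Longrightarrow> L \<in> carrier_mat m n \<Longrightarrow> B\<^sup>T *\<^sub>v v2 + v4 = 0\<^sub>v m \<Longrightarrow>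
      ((P *\<^sub>v u @\<^sub>v v2) @\<^sub>v (v3 @\<^sub>v v4)) \<bullet>
        (Phi2 n m s A C Q R (mat_inv P) *\<^sub>v ((P *\<^sub>v u @\<^sub>v v2) @\<^sub>v (v3 @\<^sub>v v4)))
      = closed_loop_form A B C Q R P L u
        - (v2 - P *\<^sub>v ((A + B * L) *\<^sub>v u)) \<bullet> (mat_inv P *\<^sub>v (v2 - P *\<^sub>v ((A + B * L) *\<^sub>v u)))
        - (v3 - (psd_sqrt Q * C) *\<^sub>v u) \<bullet> (v3 - (psd_sqrt Q * C) *\<^sub>v u)
        - (v4 - R *\<^sub>v (L *\<^sub>v u)) \<bullet> (mat_inv R *\<^sub>v (v4 - R *\<^sub>v (L *\<^sub>v u)))"
proof -
  let ?Y = "mat_inv P"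
  have Y_sym: "?Y\<^sup>T = ?Y" "symmetric ?Y" using pos_defD[OF Pi(4,1)] by auto
  have AY: "A * ?Y \<in> carrier_mat n n" and SCY: "psd_sqrt Q * C * ?Y \<in> carrier_mat s n"
    using Pi(1) A SC by auto
  have H: "0\<^sub>m m n \<in> carrier_mat m n" by simp
  have eq: "Phi2 n m s A C Q R ?Y = block4
     (- ?Y) ((A * ?Y)\<^sup>T) ((psd_sqrt Q * C * ?Y)\<^sup>T) ((0\<^sub>m m n)\<^sup>T)
     (A * ?Y) (- ?Y) (0\<^sub>m n s) (0\<^sub>m n m)
     (psd_sqrt Q * C * ?Y) (0\<^sub>m s n) (- 1\<^sub>m s) (0\<^sub>m s m)
     (0\<^sub>m m n) (0\<^sub>m m n) (0\<^sub>m m s) (- mat_inv R)"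
    unfolding Phi2_def using transpose_mult[OF A Pi(1)] Y_sym by simp
  note arrow = Pi(1) AY Pi(1) SCY H Ri(1)
  show "Phi2 n m s A C Q R ?Y \<in> carrier_mat (n + n + (s + m)) (n + n + (s + m))"
    unfolding eq by (rule arrow_carrier[OF arrow])
  show "symmetric (Phi2 n m s A C Q R ?Y)"
    unfolding eq by (rule arrow_symmetric[OF arrow]) (use Y_sym pos_defD(1)[OF Ri(4,1)] in auto)
  fix u v2 v3 v4 :: "real vec" and L :: "real mat"
  assume v: "u \<in> carrier_vec n" "v2 \<in> carrier_vec n" "v3 \<in> carrier_vec s" "v4 \<in> carrier_vec m"
    and L: "L \<in> carrier_mat m n" and v24: "B\<^sup>T *\<^sub>v v2 + v4 = 0\<^sub>v m"
  define M where "M = A + B * L"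
  have M: "M \<in> carrier_mat n n" using A B L by (simp add: M_def)
  have Pu: "P *\<^sub>v u \<in> carrier_vec n" and Mu: "M *\<^sub>v u \<in> carrier_vec n"
    and PMu: "P *\<^sub>v (M *\<^sub>v u) \<in> carrier_vec n" and Su: "(psd_sqrt Q * C) *\<^sub>v u \<in> carrier_vec s"
    and Lu: "L *\<^sub>v u \<in> carrier_vec m" and RLu: "R *\<^sub>v (L *\<^sub>v u) \<in> carrier_vec m"
    and Au: "A *\<^sub>v u \<in> carrier_vec n" and BLu: "B *\<^sub>v (L *\<^sub>v u) \<in> carrier_vec n"
    using P M SC L R A B v by auto
  \<comment> \<open>The null space condition is paired with L u to trade A for A + B L, at the price
    of the term v4 . L u.\<close>
  have "(B\<^sup>T *\<^sub>v v2 + v4) \<bullet> (L *\<^sub>v u) = 0" unfolding v24 using Lu by simp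
  hence "v2 \<bullet> (B *\<^sub>v (L *\<^sub>v u)) + v4 \<bullet> (L *\<^sub>v u) = 0"
    using transpose_vec_mult_scalar[OF B Lu v(2)] B v Lu
    by (simp add: add_scalar_prod_distrib[of _ m] mult_mat_vec_carrier[of _ m n])
  moreover have "M *\<^sub>v u = A *\<^sub>v u + B *\<^sub>v (L *\<^sub>v u)"
    unfolding M_def using A B L v by (simp add: add_mult_distrib_mat_vec[of _ n n] assoc_mult_mat_vec[of _ n m _ n])
  ultimately have cross: "v2 \<bullet> (A *\<^sub>v u) = v2 \<bullet> (M *\<^sub>v u) + v4 \<bullet> (L *\<^sub>v u)"
    using v(2) Au BLu by (simp add: scalar_prod_add_distrib[of _ n])
  have a: "(A * ?Y) *\<^sub>v (P *\<^sub>v u) = A *\<^sub>v u"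
    "(psd_sqrt Q * C * ?Y) *\<^sub>v (P *\<^sub>v u) = (psd_sqrt Q * C) *\<^sub>v u"
    using assoc_mult_mat_vec[OF A Pi(1) Pu] assoc_mult_mat_vec[OF SC Pi(1) Pu] Pi(6)[OF v(1)] by simp_all
  have comm: "(P *\<^sub>v u) \<bullet> u = u \<bullet> (P *\<^sub>v u)"
    "(P *\<^sub>v (M *\<^sub>v u)) \<bullet> (M *\<^sub>v u) = (M *\<^sub>v u) \<bullet> (P *\<^sub>v (M *\<^sub>v u))"
    "(R *\<^sub>v (L *\<^sub>v u)) \<bullet> (L *\<^sub>v u) = (L *\<^sub>v u) \<bullet> (R *\<^sub>v (L *\<^sub>v u))"
    using comm_scalar_prod v Pu PMu Mu RLu Lu by metis+
  show "((P *\<^sub>v u @\<^sub>v v2) @\<^sub>v (v3 @\<^sub>v v4)) \<bullet> (Phi2 n m s A C Q R ?Y *\<^sub>v ((P *\<^sub>v u @\<^sub>v v2) @\<^sub>v (v3 @\<^sub>v v4)))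
      = closed_loop_form A B C Q R P L u
        - (v2 - P *\<^sub>v ((A + B * L) *\<^sub>v u)) \<bullet> (mat_inv P *\<^sub>v (v2 - P *\<^sub>v ((A + B * L) *\<^sub>v u)))
        - (v3 - (psd_sqrt Q * C) *\<^sub>v u) \<bullet> (v3 - (psd_sqrt Q * C) *\<^sub>v u)
        - (v4 - R *\<^sub>v (L *\<^sub>v u)) \<bullet> (mat_inv R *\<^sub>v (v4 - R *\<^sub>v (L *\<^sub>v u)))"
    unfolding M_def[symmetric] closed_loop_form_def eq arrow_quad[OF arrow Pu v(2-4)]
      quad_diff[OF Y_sym(2) Pi(1) v(2) PMu]
      quad_diff[OF pos_defD(1)[OF Ri(4,1)] Ri(1) v(4) RLu]
      scalar_prod_diff_self[OF v(3) Su] SC_norm[OF v(1)] a Pi(6)[OF v(1)] Pi(6)[OF Mu] Ri(6)[OF Lu] comm cross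
    using Pu v(4) by simp
qed

text \<open>Any single gain with negative form is a witness: by the preceding identity the value at
  a null vector is \<open>closed_loop_form\<close> at u minus squares.\<close>

lemma Phi2_neg_def:
  assumes NB: "orthonormal_kernel_basis NB (B_tilde n m s B)" and L: "L \<in> carrier_mat m n"
    and neg: "\<And>v. v \<in> carrier_vec n \<Longrightarrow> v \<noteq> 0\<^sub>v n \<Longrightarrow> closed_loop_form A B C Q R P L v < 0"
  shows "neg_def (NB\<^sup>T * Phi2 n m s A C Q R (mat_inv P) * NB)"
  unfolding neg_def_kernel_basis_iff[OF NB B_tilde_carrier[OF B] Phi2_properties(1,2)]
proof (intro ballI impI)
  let ?p = "n + n + (s + m)"
  fix w assume w: "w \<in> carrier_vec ?p" "w \<noteq> 0\<^sub>v ?p" "B_tilde n m s B *\<^sub>v w = 0\<^sub>v m"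
  from w(1) obtain v1 v2 v3 v4 where
    v: "v1 \<in> carrier_vec n" "v2 \<in> carrier_vec n" "v3 \<in> carrier_vec s" "v4 \<in> carrier_vec m"
    and w_eq: "w = (v1 @\<^sub>v v2) @\<^sub>v (v3 @\<^sub>v v4)" by (rule split4_vec)
  have v24: "B\<^sup>T *\<^sub>v v2 + v4 = 0\<^sub>v m" using w(3) B_tilde_mult_vec[OF B v] w_eq by simp
  define u where "u = mat_inv P *\<^sub>v v1"
  have u: "u \<in> carrier_vec n" and Pu: "P *\<^sub>v u = v1" using Pi v by (auto simp: u_def)
  define M where "M = A + B * L"
  have M: "M \<in> carrier_mat n n" using A B L by (simp add: M_def)
  let ?a = "v2 - P *\<^sub>v (M *\<^sub>v u)" and ?b = "v3 - (psd_sqrt Q * C) *\<^sub>v u" and ?c = "v4 - R *\<^sub>v (L *\<^sub>v u)"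
  have c: "?a \<in> carrier_vec n" "?c \<in> carrier_vec m" using P M R L u v by auto
  note quad = Phi2_properties(3)[OF u v(2-4) L v24, unfolded Pu, folded M_def]
  note nn = Pi_nonneg[OF c(1)] scalar_prod_self_nonneg[of ?b] Ri_nonneg[OF c(2)]
  show "w \<bullet> (Phi2 n m s A C Q R (mat_inv P) *\<^sub>v w) < 0"
  proof (cases "u = 0\<^sub>v n")
    case False
    thus ?thesis unfolding w_eq quad using nn neg[OF u] by simp
  next
    case True
    hence "v1 = 0\<^sub>v n" using Pu mult_mat_zero_vec[OF P(1)] by simp
    hence nz: "v2 \<noteq> 0\<^sub>v n \<or> v3 \<noteq> 0\<^sub>v s \<or> v4 \<noteq> 0\<^sub>v m"
      using w(2) append4_eq_0_iff[OF v] w_eq by auto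
    have d: "?a = v2" "?b = v3" "?c = v4"
      using v unfolding True mult_mat_zero_vec[OF M] mult_mat_zero_vec[OF P(1)] mult_mat_zero_vec[OF SC]
        mult_mat_zero_vec[OF L] mult_mat_zero_vec[OF R(1)] by auto
    have h: "closed_loop_form A B C Q R P L u = 0"
      unfolding closed_loop_form_def M_def[symmetric] True mult_mat_zero_vec[OF M] mult_mat_zero_vec[OF C]
        mult_mat_zero_vec[OF L] mult_mat_zero_vec[OF P(1)] mult_mat_zero_vec[OF Q(1)]
        mult_mat_zero_vec[OF R(1)] by simp
    show ?thesis
      unfolding w_eq quad d h
      using nz nn[unfolded d] Pi_pos[OF v(2)] scalar_prod_self_pos[OF v(3)] Ri_pos[OF v(4)] by auto
  qed
qed

text \<open>For the optimal gain \<open>L\<close> all completed squares vanish simultaneously at \<open>v\<^sub>2 = P(A + BL)u\<close>.\<close>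

lemma Phi2_neg_defD:
  assumes NB: "orthonormal_kernel_basis NB (B_tilde n m s B)" and L: "L \<in> carrier_mat m n"
    and opt: "\<And>v. v \<in> carrier_vec n \<Longrightarrow> B\<^sup>T *\<^sub>v (P *\<^sub>v ((A + B * L) *\<^sub>v v)) + R *\<^sub>v (L *\<^sub>v v) = 0\<^sub>v m"
    and neg: "neg_def (NB\<^sup>T * Phi2 n m s A C Q R (mat_inv P) * NB)"
    and u: "u \<in> carrier_vec n" "u \<noteq> 0\<^sub>v n"
  shows "closed_loop_form A B C Q R P L u < 0"
proof -
  define M where "M = A + B * L"
  have M: "M \<in> carrier_mat n n" using A B L by (simp add: M_def)
  define v2 where "v2 = P *\<^sub>v (M *\<^sub>v u)"
  define v3 where "v3 = (psd_sqrt Q * C) *\<^sub>v u"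
  define v4 where "v4 = R *\<^sub>v (L *\<^sub>v u)"
  have v: "P *\<^sub>v u \<in> carrier_vec n" "v2 \<in> carrier_vec n" "v3 \<in> carrier_vec s" "v4 \<in> carrier_vec m"
    using P M SC R L u by (auto simp: v2_def v3_def v4_def)
  \<comment> \<open>Stationarity of L says precisely that the point where the squares vanish lies in
    the null space of \<open>B_tilde\<close>.\<close>
  have v24: "B\<^sup>T *\<^sub>v v2 + v4 = 0\<^sub>v m" using opt[OF u(1)] by (simp add: v2_def v4_def M_def)
  have "P *\<^sub>v u \<noteq> 0\<^sub>v n" using Pi(6)[OF u(1)] mult_mat_zero_vec[OF Pi(1)] u(2) by auto
  hence "((P *\<^sub>v u @\<^sub>v v2) @\<^sub>v (v3 @\<^sub>v v4)) \<bullet>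
        (Phi2 n m s A C Q R (mat_inv P) *\<^sub>v ((P *\<^sub>v u @\<^sub>v v2) @\<^sub>v (v3 @\<^sub>v v4))) < 0"
    using neg[unfolded neg_def_kernel_basis_iff[OF NB B_tilde_carrier[OF B] Phi2_properties(1,2)]]
      v24 B_tilde_mult_vec[OF B v] append4_eq_0_iff[OF v] v
    by (auto dest!: bspec[of _ _ "(P *\<^sub>v u @\<^sub>v v2) @\<^sub>v (v3 @\<^sub>v v4)"])
  moreover have "v2 - P *\<^sub>v (M *\<^sub>v u) = 0\<^sub>v n" "v3 - (psd_sqrt Q * C) *\<^sub>v u = 0\<^sub>v s"
    "v4 - R *\<^sub>v (L *\<^sub>v u) = 0\<^sub>v m"
    using v by (auto simp: v2_def v3_def v4_def)
  ultimately show ?thesis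
    unfolding Phi2_properties(3)[OF u(1) v(2-4) L v24, folded M_def]
    using mult_mat_zero_vec[OF Pi(1)] mult_mat_zero_vec[OF Ri(1)] by simp
qed

end

end

section \<open>Eliminating the feedback gain\<close>

lemma symmetric_add:
  assumes "symmetric X" "symmetric Y" "X \<in> carrier_mat n n" "Y \<in> carrier_mat n n"
  shows "symmetric (X + Y)"
  using assms transpose_add[OF assms(3,4)] by (simp add: symmetric_def)

lemma symmetric_minus:
  assumes "symmetric X" "symmetric Y" "X \<in> carrier_mat n n" "Y \<in> carrier_mat n n"
  shows "symmetric (X - Y)"
proof -
  have "(X - Y)\<^sup>T = X\<^sup>T - Y\<^sup>T" using assms(3,4) by (intro eq_matI) auto
  thus ?thesis using assms by (simp add: symmetric_def)
qed

lemma congruence_form: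
  assumes W: "W \<in> carrier_mat p p" and T: "T \<in> carrier_mat p n"
  shows "T\<^sup>T * (W * T) \<in> carrier_mat n n"
    and "symmetric W \<Longrightarrow> symmetric (T\<^sup>T * (W * T))"
    and "\<And>v. v \<in> carrier_vec n \<Longrightarrow> v \<bullet> ((T\<^sup>T * (W * T)) *\<^sub>v v) = (T *\<^sub>v v) \<bullet> (W *\<^sub>v (T *\<^sub>v v))"
proof -
  show c: "T\<^sup>T * (W * T) \<in> carrier_mat n n" using W T by simp
  have WT: "W * T \<in> carrier_mat p n" using W T by simp
  show "symmetric (T\<^sup>T * (W * T))" if "symmetric W"
  proof -
    have "(T\<^sup>T * (W * T))\<^sup>T = (W * T)\<^sup>T * T"
      using transpose_mult[of "T\<^sup>T" n p "W * T" n] T WT by simp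
    also have "\<dots> = T\<^sup>T * W\<^sup>T * T" using transpose_mult[OF W T] by simp
    also have "\<dots> = T\<^sup>T * (W * T)" using W T that by (simp add: symmetric_def)
    finally show ?thesis using symmetric_carrier[OF c] by simp
  qed
  fix v :: "real vec" assume v: "v \<in> carrier_vec n"
  have Tv: "T *\<^sub>v v \<in> carrier_vec p" "W *\<^sub>v (T *\<^sub>v v) \<in> carrier_vec p" using W T v by auto
  have "(T\<^sup>T * (W * T)) *\<^sub>v v = T\<^sup>T *\<^sub>v (W *\<^sub>v (T *\<^sub>v v))"
    using W T WT v by (simp add: assoc_mult_mat_vec[of _ n p _ n] assoc_mult_mat_vec[of _ p p _ n])
  thus "v \<bullet> ((T\<^sup>T * (W * T)) *\<^sub>v v) = (T *\<^sub>v v) \<bullet> (W *\<^sub>v (T *\<^sub>v v))"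
    using adjoint_right[OF T v Tv(2)] comm_scalar_prod[OF Tv] by simp
qed

text \<open>Rank s yields s independent columns, a basis of the whole space, so w = C x for some x.
  Then w . w = (C^T w) . x = 0.\<close>

lemma full_row_rank_transpose_inj:
  assumes C: "(C :: real mat) \<in> carrier_mat s n" and rank: "vec_space.rank s C = s"
    and w: "w \<in> carrier_vec s" "C\<^sup>T *\<^sub>v w = 0\<^sub>v n"
  shows "w = 0\<^sub>v s"
proof -
  interpret vec_space "TYPE(real)" s .
  have cols: "set (cols C) \<subseteq> carrier_vec s" using C cols_dim by blast
  obtain S where S: "maximal S (\<lambda>T. T \<subseteq> set (cols C) \<and> lin_indpt T)"
    using maximal_exists_superset[of "set (cols C)" "\<lambda>T. T \<subseteq> set (cols C) \<and> lin_indpt T" "{}"]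
      subset_li_is_li[of "set (unit_vecs s)" "{}"] unit_vecs_basis
    unfolding basis_def by auto
  have card: "card S = s" using rank_card_indpt[OF C S] rank by simp
  have Sc: "S \<subseteq> set (cols C)" "lin_indpt S" using S by (auto simp: maximal_def)
  hence "basis S" using card cols
    by (intro dim_li_is_basis) (auto simp: dim_is_n intro: finite_subset)
  hence "span S = carrier_vec s" by (simp add: basis_def)
  hence "w \<in> col_space C" using w(1) span_is_monotone[OF Sc(1)] unfolding col_space_def by auto
  then obtain x where x: "x \<in> carrier_vec n" "C *\<^sub>v x = w" using col_space_eq[OF C] C by auto
  have "w \<bullet> w = (C\<^sup>T *\<^sub>v w) \<bullet> x" using transpose_vec_mult_scalar[OF C x(1) w(1)] x(2) by simp
  also have "\<dots> = 0" using w(2) x(1) by simp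
  finally show ?thesis using scalar_prod_self_eq_0[OF w(1)] by simp
qed

text \<open>This is the Riccati gain L = - (R + B^T P B)^-1 B^T P A. The second conclusion is the
  first-order condition for minimising \<open>closed_loop_form\<close> over the input L v, stated at
  each vector because that is how it is applied.\<close>

lemma exists_optimal_gain:
  assumes A: "A \<in> carrier_mat n n" and B: "B \<in> carrier_mat n m"
    and R: "R \<in> carrier_mat m m" "pos_def R" and P: "P \<in> carrier_mat n n" "pos_def P"
  obtains L where "L \<in> carrier_mat m n"
    "\<And>v. v \<in> carrier_vec n \<Longrightarrow> B\<^sup>T *\<^sub>v (P *\<^sub>v ((A + B * L) *\<^sub>v v)) + R *\<^sub>v (L *\<^sub>v v) = 0\<^sub>v m"
proof -
  define G where "G = B\<^sup>T * (P * B) + R"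
  note BPB = congruence_form[OF P(1) B]
  have G: "G \<in> carrier_mat m m" using BPB R by (simp add: G_def)
  have "symmetric G"
    unfolding G_def by (rule symmetric_add[OF BPB(2) _ BPB(1) R(1)])
      (use pos_defD(1)[OF P(2,1)] pos_defD(1)[OF R(2,1)] in auto)
  moreover have "v \<bullet> (G *\<^sub>v v) > 0" if v: "v \<in> carrier_vec m" "v \<noteq> 0\<^sub>v m" for v
  proof -
    have "v \<bullet> (G *\<^sub>v v) = (B *\<^sub>v v) \<bullet> (P *\<^sub>v (B *\<^sub>v v)) + v \<bullet> (R *\<^sub>v v)"
      unfolding G_def BPB(3)[OF v(1), symmetric] using v BPB(1) R
      by (simp add: add_mult_distrib_mat_vec[of _ m m] scalar_prod_add_distrib[of _ m])
    thus ?thesis using pos_defD(4)[OF P(2,1), of "B *\<^sub>v v"] pos_defD(3)[OF R(2,1) v] B v by simp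
  qed
  ultimately have "pos_def G" using G by (auto simp: pos_def_def)
  note Gi = pos_def_inverse[OF this G]
  define L where "L = - (mat_inv G * (B\<^sup>T * (P * A)))"
  have L: "L \<in> carrier_mat m n" using Gi(1) A B P by (simp add: L_def)
  show thesis
  proof (rule that[OF L])
    fix v :: "real vec" assume v: "v \<in> carrier_vec n"
    let ?b = "B\<^sup>T *\<^sub>v (P *\<^sub>v (A *\<^sub>v v))"
    have b: "?b \<in> carrier_vec m" and Lv: "L *\<^sub>v v \<in> carrier_vec m" using A B P L v by auto
    have BTPA: "B\<^sup>T * (P * A) \<in> carrier_mat m n" using A B P by simp
    have "(B\<^sup>T * (P * A)) *\<^sub>v v = ?b"
      using A B P v by (simp add: assoc_mult_mat_vec[of _ m n _ n] assoc_mult_mat_vec[of _ n n _ n])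
    hence "L *\<^sub>v v = - (mat_inv G *\<^sub>v ?b)"
      unfolding L_def using A Gi(1) BTPA v assoc_mult_mat_vec[OF Gi(1) BTPA v] by simp
    hence "L *\<^sub>v v + mat_inv G *\<^sub>v ?b = 0\<^sub>v m" using Gi(1) b by auto
    hence "G *\<^sub>v (L *\<^sub>v v) + ?b = 0\<^sub>v m"
      using mult_add_distrib_mat_vec[OF G Lv, of "mat_inv G *\<^sub>v ?b"] Gi(1) Gi(5)[OF b] b G by simp
    moreover have "G *\<^sub>v (L *\<^sub>v v) = B\<^sup>T *\<^sub>v (P *\<^sub>v (B *\<^sub>v (L *\<^sub>v v))) + R *\<^sub>v (L *\<^sub>v v)"
      unfolding G_def using B P R Lv BPB(1)
      by (simp add: add_mult_distrib_mat_vec[of _ m m] assoc_mult_mat_vec[of _ m n _ m]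
          assoc_mult_mat_vec[of _ n n _ m])
    moreover have "B\<^sup>T *\<^sub>v (P *\<^sub>v ((A + B * L) *\<^sub>v v)) = ?b + B\<^sup>T *\<^sub>v (P *\<^sub>v (B *\<^sub>v (L *\<^sub>v v)))"
      using A B P L v Lv
      by (simp add: add_mult_distrib_mat_vec[of _ n n] assoc_mult_mat_vec[of _ n m _ n]
          mult_add_distrib_mat_vec[of _ n n] mult_add_distrib_mat_vec[of _ m n])
    moreover have c: "B\<^sup>T *\<^sub>v (P *\<^sub>v (B *\<^sub>v (L *\<^sub>v v))) \<in> carrier_vec m" "R *\<^sub>v (L *\<^sub>v v) \<in> carrier_vec m"
      using B P R Lv by auto
    ultimately show "B\<^sup>T *\<^sub>v (P *\<^sub>v ((A + B * L) *\<^sub>v v)) + R *\<^sub>v (L *\<^sub>v v) = 0\<^sub>v m"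
      using b comm_add_vec[OF b add_carrier_vec[OF c]] assoc_add_vec[OF b c] by simp
  qed
qed

context
  fixes n m s :: nat and A B C Q R P :: "real mat"
  assumes A: "A \<in> carrier_mat n n" and B: "B \<in> carrier_mat n m" and C: "C \<in> carrier_mat s n"
    and Q: "Q \<in> carrier_mat s s" "pos_semidef Q" and R: "R \<in> carrier_mat m m" "pos_def R"
    and P: "P \<in> carrier_mat n n" "pos_def P"
begin

text \<open>Pairing the stationarity condition with e produces the cross terms of the two quadratic
  forms, whose sum therefore vanishes.\<close>

lemma closed_loop_form_change_gain:
  assumes L: "L \<in> carrier_mat m n" and K: "K \<in> carrier_mat m n"
    and v: "v \<in> carrier_vec n" and e: "e \<in> carrier_vec m" and Kv: "K *\<^sub>v v = L *\<^sub>v v + e"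
    and opt: "B\<^sup>T *\<^sub>v (P *\<^sub>v ((A + B * L) *\<^sub>v v)) + R *\<^sub>v (L *\<^sub>v v) = 0\<^sub>v m"
  shows "closed_loop_form A B C Q R P K v
    = closed_loop_form A B C Q R P L v + ((B *\<^sub>v e) \<bullet> (P *\<^sub>v (B *\<^sub>v e)) + e \<bullet> (R *\<^sub>v e))"
proof -
  define M where "M = A + B * L"
  have M: "M \<in> carrier_mat n n" using A B L by (simp add: M_def)
  have Lv: "L *\<^sub>v v \<in> carrier_vec m" and Mv: "M *\<^sub>v v \<in> carrier_vec n" and Be: "B *\<^sub>v e \<in> carrier_vec n"
    and PMv: "P *\<^sub>v (M *\<^sub>v v) \<in> carrier_vec n" and RLv: "R *\<^sub>v (L *\<^sub>v v) \<in> carrier_vec m"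
    using L M B P R v e by auto
  have "(A + B * K) *\<^sub>v v = A *\<^sub>v v + B *\<^sub>v (L *\<^sub>v v + e)"
    using A B K v Kv by (simp add: add_mult_distrib_mat_vec[of _ n n] assoc_mult_mat_vec[of _ n m _ n])
  also have "\<dots> = M *\<^sub>v v + B *\<^sub>v e"
    unfolding M_def using A B L v e Lv
    by (simp add: add_mult_distrib_mat_vec[of _ n n] assoc_mult_mat_vec[of _ n m _ n]
        mult_add_distrib_mat_vec[of _ n m] assoc_add_vec[of _ n])
  finally have Kv': "(A + B * K) *\<^sub>v v = M *\<^sub>v v + B *\<^sub>v e" .
  have "e \<bullet> (B\<^sup>T *\<^sub>v (P *\<^sub>v (M *\<^sub>v v)) + R *\<^sub>v (L *\<^sub>v v)) = 0"
    using opt e by (simp add: M_def)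
  hence "(M *\<^sub>v v) \<bullet> (P *\<^sub>v (B *\<^sub>v e)) + (L *\<^sub>v v) \<bullet> (R *\<^sub>v e) = 0"
    using e B RLv PMv adjoint_right[OF B e PMv] comm_scalar_prod[OF PMv Be]
      symmetric_swap[OF pos_defD(1)[OF P(2,1)] P(1) Mv Be]
      symmetric_swap[OF pos_defD(1)[OF R(2,1)] R(1) Lv e]
    by (simp add: scalar_prod_add_distrib[of _ m] mult_mat_vec_carrier[of _ m n])
  thus ?thesis
    unfolding closed_loop_form_def Kv' Kv M_def[symmetric]
      quad_add[OF pos_defD(1)[OF P(2,1)] P(1) Mv Be] quad_add[OF pos_defD(1)[OF R(2,1)] R(1) Lv e]
    by simp
qed

text \<open>With \<open>S\<close> the matrix of \<open>- closed_loop_form A B C Q R P L\<close>, the gain \<open>K\<close> below is chosen such that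
  \<open>K C = L \<Pi>\<close>, where \<open>\<Pi>\<close> is the projection along \<open>ker C\<close> that is orthogonal for \<open>S\<close>.
  The form then splits into a negative form on \<open>\<Pi> v\<close> and the uncontrolled form on \<open>v - \<Pi> v\<close>.\<close>

lemma exists_output_gain:
  assumes C_inj: "\<And>w. w \<in> carrier_vec s \<Longrightarrow> C\<^sup>T *\<^sub>v w = 0\<^sub>v n \<Longrightarrow> w = 0\<^sub>v s"
    and L: "L \<in> carrier_mat m n"
    and opt: "\<And>v. v \<in> carrier_vec n \<Longrightarrow> B\<^sup>T *\<^sub>v (P *\<^sub>v ((A + B * L) *\<^sub>v v)) + R *\<^sub>v (L *\<^sub>v v) = 0\<^sub>v m"
    and neg: "\<And>v. v \<in> carrier_vec n \<Longrightarrow> v \<noteq> 0\<^sub>v n \<Longrightarrow> closed_loop_form A B C Q R P L v < 0"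
    and ker: "\<And>v. v \<in> carrier_vec n \<Longrightarrow> v \<noteq> 0\<^sub>v n \<Longrightarrow> C *\<^sub>v v = 0\<^sub>v s \<Longrightarrow>
       (A *\<^sub>v v) \<bullet> (P *\<^sub>v (A *\<^sub>v v)) < v \<bullet> (P *\<^sub>v v)"
  obtains K where "K \<in> carrier_mat m s"
    "\<And>v. v \<in> carrier_vec n \<Longrightarrow> v \<noteq> 0\<^sub>v n \<Longrightarrow> closed_loop_form A B C Q R P (K * C) v < 0"
proof -
  define M where "M = A + B * L"
  have M: "M \<in> carrier_mat n n" using A B L by (simp add: M_def)
  have symQ: "symmetric Q" using Q by (simp add: pos_semidef_def)
  note c1 = congruence_form[OF P(1) M] and c2 = congruence_form[OF Q(1) C] and c3 = congruence_form[OF R(1) L]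
  define S where "S = P - M\<^sup>T * (P * M) - C\<^sup>T * (Q * C) - L\<^sup>T * (R * L)"
  have S1: "P - M\<^sup>T * (P * M) \<in> carrier_mat n n" and S2: "P - M\<^sup>T * (P * M) - C\<^sup>T * (Q * C) \<in> carrier_mat n n"
    using c1(1) c2(1) by (auto intro: minus_carrier_mat)
  have S: "S \<in> carrier_mat n n" unfolding S_def using c3(1) by (rule minus_carrier_mat)
  have "symmetric (P - M\<^sup>T * (P * M))"
    by (rule symmetric_minus[OF _ c1(2) P(1) c1(1)]) (use pos_defD(1)[OF P(2,1)] in auto)
  hence "symmetric (P - M\<^sup>T * (P * M) - C\<^sup>T * (Q * C))"
    by (rule symmetric_minus[OF _ c2(2) S1 c2(1)]) (use symQ in auto)
  hence symS: "symmetric S" unfolding S_def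
    by (rule symmetric_minus[OF _ c3(2) S2 c3(1)]) (use pos_defD(1)[OF R(2,1)] in auto)
  have quadS: "v \<bullet> (S *\<^sub>v v) = - closed_loop_form A B C Q R P L v" if v: "v \<in> carrier_vec n" for v
    unfolding closed_loop_form_def M_def[symmetric] c1(3)[OF v, symmetric] c2(3)[OF v, symmetric] c3(3)[OF v, symmetric]
    unfolding S_def using v P c1(1) c2(1) c3(1)
    by (simp add: minus_mult_distrib_mat_vec[OF S2 c3(1)] minus_mult_distrib_mat_vec[OF S1 c2(1)]
        minus_mult_distrib_mat_vec[OF P(1) c1(1)] scalar_prod_minus_distrib[of _ n])
  have pdS: "pos_def S" using symS S neg quadS by (auto simp: pos_def_def)
  note Si = pos_def_inverse[OF pdS S]
  have CT: "C\<^sup>T \<in> carrier_mat n s" using C by simp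
  \<comment> \<open>This is C S^-1 C^T; the double transpose makes it an instance of
    \<open>congruence_form\<close>. It is definite because C^T is injective, which is where full row
    rank enters.\<close>
  define E where "E = (C\<^sup>T)\<^sup>T * (mat_inv S * C\<^sup>T)"
  note c4 = congruence_form[OF Si(1) CT, folded E_def]
  have "w \<bullet> (E *\<^sub>v w) > 0" if w: "w \<in> carrier_vec s" "w \<noteq> 0\<^sub>v s" for w
    unfolding c4(3)[OF w(1)] using w C_inj CT by (intro pos_defD(3)[OF Si(4,1)]) auto
  hence "pos_def E" using c4(1) c4(2)[OF pos_defD(1)[OF Si(4,1)]] by (auto simp: pos_def_def)
  note Ei = pos_def_inverse[OF this c4(1)]
  \<comment> \<open>The projection is \<Pi> = S^-1 C^T E^-1 C. Its right factor C is split off, so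
    that K C = L \<Pi>.\<close>
  define K where "K = L * (mat_inv S * (C\<^sup>T * mat_inv E))"
  have K: "K \<in> carrier_mat m s" using L Si(1) CT Ei(1) by (simp add: K_def)
  show thesis
  proof (rule that[OF K])
    fix v :: "real vec" assume v: "v \<in> carrier_vec n" "v \<noteq> 0\<^sub>v n"
    define y where "y = mat_inv E *\<^sub>v (C *\<^sub>v v)"
    \<comment> \<open>Here z is \<Pi> v. Since S z lies in the range of C^T, it is orthogonal to ker
      C, which contains v - z.\<close>
    define z where "z = mat_inv S *\<^sub>v (C\<^sup>T *\<^sub>v y)"
    define d where "d = v - z"
    have Cv: "C *\<^sub>v v \<in> carrier_vec s" and y: "y \<in> carrier_vec s" using C Ei(1) v by (auto simp: y_def)
    have CTy: "C\<^sup>T *\<^sub>v y \<in> carrier_vec n" using CT y by simp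
    have z: "z \<in> carrier_vec n" using Si(1) CTy by (simp add: z_def)
    have d: "d \<in> carrier_vec n" using v z by (simp add: d_def)
    have vzd: "v = z + d" using v z by (auto simp: d_def vec_eq_iff)
    have Sz: "S *\<^sub>v z = C\<^sup>T *\<^sub>v y" unfolding z_def by (rule Si(5)[OF CTy])
    have "C *\<^sub>v z = E *\<^sub>v y"
      unfolding z_def E_def using C CT Si(1) y
      by (simp add: assoc_mult_mat_vec[of _ s n _ s] assoc_mult_mat_vec[of _ n n _ s])
    also have "\<dots> = C *\<^sub>v v" unfolding y_def by (rule Ei(5)[OF Cv])
    finally have "C *\<^sub>v d = 0\<^sub>v s"
      unfolding d_def using mult_minus_distrib_mat_vec[OF C v(1) z] Cv by simp
    note Cd = this
    have "d \<bullet> (S *\<^sub>v z) = y \<bullet> (C *\<^sub>v d)" unfolding Sz by (rule adjoint_right[OF C d y])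
    hence "z \<bullet> (S *\<^sub>v d) = 0" using symmetric_swap[OF symS S z d] Cd y by simp
    hence split: "v \<bullet> (S *\<^sub>v v) = z \<bullet> (S *\<^sub>v z) + d \<bullet> (S *\<^sub>v d)"
      unfolding vzd quad_add[OF symS S z d] by simp
    have KC: "K * C \<in> carrier_mat m n" using K C by simp
    have X3: "C\<^sup>T * mat_inv E \<in> carrier_mat n s" using CT Ei(1) by simp
    have X2: "mat_inv S * (C\<^sup>T * mat_inv E) \<in> carrier_mat n s" using Si(1) X3 by simp
    have Lz: "(K * C) *\<^sub>v v = L *\<^sub>v z"
      unfolding assoc_mult_mat_vec[OF K C v(1)] unfolding K_def assoc_mult_mat_vec[OF L X2 Cv]
        assoc_mult_mat_vec[OF Si(1) X3 Cv] assoc_mult_mat_vec[OF CT Ei(1) Cv] z_def y_def ..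
    \<comment> \<open>One deviation serves two comparisons with L: the gain K C at v and the zero
      gain at d. The increases are equal and cancel when f1 and f2 are combined.\<close>
    let ?e = "- (L *\<^sub>v d)"
    have Ld: "L *\<^sub>v d \<in> carrier_vec m" and Lzc: "L *\<^sub>v z \<in> carrier_vec m" using L d z by auto
    hence e: "?e \<in> carrier_vec m" by simp
    have "(K * C) *\<^sub>v v = L *\<^sub>v v + ?e"
      unfolding Lz unfolding vzd mult_add_distrib_mat_vec[OF L z d] using Ld Lzc by (auto simp: vec_eq_iff)
    note f1 = closed_loop_form_change_gain[OF L KC v(1) e this opt[OF v(1)]]
    have "0\<^sub>m m n *\<^sub>v d = L *\<^sub>v d + ?e" using d Ld by auto
    note f2 = closed_loop_form_change_gain[OF L zero_carrier_mat d e this opt[OF d]]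
    have f3: "closed_loop_form A B C Q R P (0\<^sub>m m n) d = (A *\<^sub>v d) \<bullet> (P *\<^sub>v (A *\<^sub>v d)) - d \<bullet> (P *\<^sub>v d)"
      unfolding closed_loop_form_def Cd using A B Q R d by simp
    have eq: "closed_loop_form A B C Q R P (K * C) v
        = (A *\<^sub>v d) \<bullet> (P *\<^sub>v (A *\<^sub>v d)) - d \<bullet> (P *\<^sub>v d) - z \<bullet> (S *\<^sub>v z)"
      using f1 f2 f3 split quadS[OF v(1)] quadS[OF d] by simp
    \<comment> \<open>Strictness comes from S if v = z, and from the condition on ker C
      otherwise.\<close>
    show "closed_loop_form A B C Q R P (K * C) v < 0"
    proof (cases "d = 0\<^sub>v n")
      case True
      hence "z \<noteq> 0\<^sub>v n" using v vzd by auto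
      thus ?thesis unfolding eq using pos_defD(3)[OF pdS S z] True A P by simp
    next
      case False
      thus ?thesis unfolding eq using ker[OF d False Cd] pos_defD(4)[OF pdS S z] by simp
    qed
  qed
qed

end

section \<open>Lyapunov equations\<close>

lemma smult_mat_pow:
  assumes "(M :: 'a :: comm_ring_1 mat) \<in> carrier_mat n n"
  shows "(c \<cdot>\<^sub>m M) ^\<^sub>m k = c ^ k \<cdot>\<^sub>m M ^\<^sub>m k"
proof (induction k)
  case 0
  show ?case using assms by (auto intro!: eq_matI)
next
  case (Suc k)
  have Mk: "M ^\<^sub>m k \<in> carrier_mat n n" using assms by simp
  have "a \<cdot>\<^sub>m (b \<cdot>\<^sub>m X) = (a * b) \<cdot>\<^sub>m X" for a b and X :: "'a mat"
    by (rule eq_matI) (auto simp: mult.assoc)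
  thus ?case using assms Mk
    by (simp add: Suc.IH mult_smult_assoc_mat[of _ n n _ n] mult_smult_distrib[of _ n n _ n] mult.commute)
qed

text \<open>Powers stay bounded when the spectral radius is below 1. Applied to M / r, with r still
  above the spectral radius of M, boundedness becomes decay like r^k.\<close>

lemma pow_mat_geometric_bound:
  assumes M: "M \<in> carrier_mat n n" and stable: "complex_spectrum M \<subseteq> open_unit_disc"
  obtains c r where "0 \<le> c" "0 < r" "r < 1" "\<And>k i j. i < n \<Longrightarrow> j < n \<Longrightarrow> \<bar>(M ^\<^sub>m k) $$ (i, j)\<bar> \<le> c * r ^ k"
proof (cases "n = 0")
  \<comment> \<open>In dimension 0 there is no eigenvalue, hence no maximum to define the spectral
    radius; any constants in range will do.\<close>
  case True
  thus thesis using that[of 0 "1/2"] by simp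
next
  case False
  let ?M = "map_mat complex_of_real M"
  have Mc: "?M \<in> carrier_mat n n" using M by simp
  have "spectral_radius ?M \<in> norm ` spectrum ?M" using spectral_radius_mem_max(1)[OF Mc] False by simp
  hence sr: "spectral_radius ?M < 1"
    using stable by (auto simp: complex_spectrum_def open_unit_disc_def)
  \<comment> \<open>The midpoint between the spectral radius and 1; the maximum with 0 makes r > 0
    immediate, as the division by r requires.\<close>
  define r where "r = (1 + max 0 (spectral_radius ?M)) / 2"
  have r: "0 < r" "r < 1" "spectral_radius ?M < r" using sr by (auto simp: r_def)
  define N where "N = complex_of_real (1 / r) \<cdot>\<^sub>m ?M"
  have N: "N \<in> carrier_mat n n" using Mc by (simp add: N_def)
  have "spectral_radius N \<in> norm ` spectrum N" using spectral_radius_mem_max(1)[OF N] False by simp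
  then obtain z v where z: "norm z = spectral_radius N"
    and v: "v \<in> carrier_vec n" "v \<noteq> 0\<^sub>v n" "N *\<^sub>v v = z \<cdot>\<^sub>v v"
    using N by (auto simp: spectrum_def eigenvalue_def eigenvector_def)
  have "N *\<^sub>v v = complex_of_real (1 / r) \<cdot>\<^sub>v (?M *\<^sub>v v)"
    unfolding N_def using Mc v(1) by (auto simp: vec_eq_iff)
  hence "?M *\<^sub>v v = (complex_of_real r * z) \<cdot>\<^sub>v v"
    using v r(1) M by (auto simp: vec_eq_iff field_simps)
  hence "complex_of_real r * z \<in> spectrum ?M"
    using v M by (auto simp: spectrum_def eigenvalue_def eigenvector_def)
  hence "norm (complex_of_real r * z) \<le> spectral_radius ?M"
    using spectral_radius_mem_max(2)[OF Mc] False by blast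
  hence "r * spectral_radius N \<le> spectral_radius ?M" using r(1) z by (simp add: norm_mult)
  hence "r * spectral_radius N < r * 1" using r(3) by linarith
  hence "spectral_radius N < 1" using mult_less_cancel_left_pos[OF r(1)] by blast
  from spectral_radius_jnf_norm_bound_less_1_upper_triangular[OF N this]
  obtain c where c: "\<And>k. norm_bound (N ^\<^sub>m k) c" by blast
  have bound: "\<bar>(M ^\<^sub>m k) $$ (i, j)\<bar> \<le> max 0 c * r ^ k" if ij: "i < n" "j < n" for k i j
  proof -
    have Mk: "M ^\<^sub>m k \<in> carrier_mat n n" using M by simp
    have "N ^\<^sub>m k = complex_of_real (1 / r) ^ k \<cdot>\<^sub>m map_mat complex_of_real (M ^\<^sub>m k)"
      unfolding N_def of_real_hom.mat_hom_pow[OF M] by (rule smult_mat_pow[OF Mc])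
    hence "norm ((N ^\<^sub>m k) $$ (i, j)) = (1 / r) ^ k * \<bar>(M ^\<^sub>m k) $$ (i, j)\<bar>"
      using ij carrier_matD[OF Mk] r(1) by (simp add: norm_mult norm_power norm_divide)
    hence "\<bar>(M ^\<^sub>m k) $$ (i, j)\<bar> = norm ((N ^\<^sub>m k) $$ (i, j)) * r ^ k"
      using r(1) by (simp add: field_simps power_divide)
    also have "norm ((N ^\<^sub>m k) $$ (i, j)) \<le> c"
      using c[of k] ij N by (auto simp: norm_bound_def)
    also have "c \<le> max 0 c" by simp
    finally show ?thesis using r(1) by (simp add: mult_right_mono)
  qed
  show thesis by (rule that[of "max 0 c" r]) (use r bound in auto)
qed

section \<open>Trajectories and the Lyapunov series\<close>

lemma trajectory_carrier:
  assumes "M \<in> carrier_mat n n" "x \<in> carrier_vec n"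
  shows "trajectory M x k \<in> carrier_vec n"
  using assms by (induction k) auto

text \<open>\<open>trajectory\<close> recurses at the last step; peeling off the first one relates
  the cost from M x to the cost from x.\<close>

lemma trajectory_shift: "trajectory M (M *\<^sub>v x) k = trajectory M x (Suc k)"
  by (induction k) auto

lemma trajectory_pow:
  assumes M: "M \<in> carrier_mat n n" and x: "x \<in> carrier_vec n"
  shows "trajectory M x k = M ^\<^sub>m k *\<^sub>v x"
  using x
proof (induction k arbitrary: x)
  case 0
  thus ?case using M by simp
next
  case (Suc k)
  have "trajectory M x (Suc k) = M ^\<^sub>m k *\<^sub>v (M *\<^sub>v x)"
    using Suc.IH[of "M *\<^sub>v x"] Suc.prems M by (simp del: trajectory.simps add: trajectory_shift[symmetric])
  thus ?case using M Suc.prems assoc_mult_mat_vec[of "M ^\<^sub>m k" n n M n x] by simp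
qed

text \<open>P is the entrywise sum of (M^k)^T W M^k. The series along trajectories is at once the
  value of a cost and, after a shift of the index, the Lyapunov equation, so no separate matrix
  equation is stated.\<close>

lemma lyapunov_solution_exists:
  assumes M: "M \<in> carrier_mat n n" and stable: "complex_spectrum M \<subseteq> open_unit_disc"
    and W: "W \<in> carrier_mat n n" "symmetric W"
  obtains P where "P \<in> carrier_mat n n" "symmetric P"
    "\<And>x. x \<in> carrier_vec n \<Longrightarrow>
       (\<lambda>k. trajectory M x k \<bullet> (W *\<^sub>v trajectory M x k)) sums (x \<bullet> (P *\<^sub>v x))"
proof -
  obtain c r where c: "0 \<le> c" and r: "0 < r" "r < 1"
    and bound: "\<And>k i j. i < n \<Longrightarrow> j < n \<Longrightarrow> \<bar>(M ^\<^sub>m k) $$ (i, j)\<bar> \<le> c * r ^ k"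
    using pow_mat_geometric_bound[OF M stable] by blast
  define N where "N k = (M ^\<^sub>m k)\<^sup>T * (W * M ^\<^sub>m k)" for k
  have Mk: "M ^\<^sub>m k \<in> carrier_mat n n" for k using M by simp
  note cong = congruence_form[OF W(1) Mk, folded N_def]
  have entry: "N k $$ (i, j) = (\<Sum>a\<in>{0..<n}. \<Sum>b\<in>{0..<n}. (M ^\<^sub>m k) $$ (a, i) * (W $$ (a, b) * (M ^\<^sub>m k) $$ (b, j)))"
    if "i < n" "j < n" for i j k
    using that carrier_matD[OF Mk[of k]] carrier_matD[OF W(1)]
    by (simp add: N_def scalar_prod_def sum_distrib_left)
  have summable: "summable (\<lambda>k. N k $$ (i, j))" if ij: "i < n" "j < n" for i j
  proof (rule summable_comparison_test)
    \<comment> \<open>Each summand has two factors from M^k, each at most c r^k, so the majorant is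
      geometric with ratio r^2.\<close>
    let ?K = "\<Sum>a\<in>{0..<n}. \<Sum>b\<in>{0..<n}. c * \<bar>W $$ (a, b)\<bar> * c"
    show "summable (\<lambda>k. ?K * (r ^ 2) ^ k)"
      using r by (intro summable_mult summable_geometric) (simp add: power_less_one_iff)
    have "norm (N k $$ (i, j)) \<le> ?K * (r ^ 2) ^ k" for k
    proof -
      have "norm (N k $$ (i, j)) \<le> (\<Sum>a\<in>{0..<n}. \<Sum>b\<in>{0..<n}.
          norm ((M ^\<^sub>m k) $$ (a, i) * (W $$ (a, b) * (M ^\<^sub>m k) $$ (b, j))))"
        unfolding entry[OF ij] by (intro order_trans[OF norm_sum] sum_mono) (rule order_refl)
      also have "\<dots> \<le> (\<Sum>a\<in>{0..<n}. \<Sum>b\<in>{0..<n}. (c * r ^ k) * (\<bar>W $$ (a, b)\<bar> * (c * r ^ k)))"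
        using ij bound c r by (intro sum_mono) (auto simp: abs_mult intro!: mult_mono)
      also have "\<dots> = ?K * (r ^ 2) ^ k"
        unfolding sum_distrib_right
        by (intro sum.cong refl) (simp add: power2_eq_square power_mult_distrib mult_ac)
      finally show ?thesis .
    qed
    thus "\<exists>k0. \<forall>k\<ge>k0. norm (N k $$ (i, j)) \<le> ?K * (r ^ 2) ^ k" by blast
  qed
  define P where "P = mat n n (\<lambda>(i, j). \<Sum>k. N k $$ (i, j))"
  have P: "P \<in> carrier_mat n n" by (simp add: P_def)
  have "N k $$ (i, j) = N k $$ (j, i)" if "i < n" "j < n" for i j k
    using cong(2)[OF W(2), of k] cong(1)[of k] that by (metis carrier_matD index_transpose_mat(1) symmetric_def)
  hence "P\<^sup>T = P" by (intro eq_matI) (auto simp: P_def)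
  hence "symmetric P" using symmetric_carrier[OF P] by simp
  moreover have "(\<lambda>k. trajectory M x k \<bullet> (W *\<^sub>v trajectory M x k)) sums (x \<bullet> (P *\<^sub>v x))"
    if x: "x \<in> carrier_vec n" for x
  proof -
    have quad: "x \<bullet> (X *\<^sub>v x) = (\<Sum>i\<in>{0..<n}. \<Sum>j\<in>{0..<n}. x $ i * (X $$ (i, j) * x $ j))"
      if "X \<in> carrier_mat n n" for X
      using that x by (simp add: scalar_prod_def sum_distrib_left)
    have "(\<lambda>k. \<Sum>i\<in>{0..<n}. \<Sum>j\<in>{0..<n}. x $ i * (N k $$ (i, j) * x $ j)) sums
        (\<Sum>i\<in>{0..<n}. \<Sum>j\<in>{0..<n}. x $ i * (P $$ (i, j) * x $ j))"
      by (intro sums_sum sums_mult sums_mult2) (auto simp: P_def summable intro!: summable_sums)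
    thus ?thesis
      unfolding quad[OF P, symmetric] quad[OF cong(1), symmetric] cong(3)[OF x]
        trajectory_pow[OF M x] .
  qed
  ultimately show thesis using that P by blast
qed

text \<open>Let q be the form of P and (a, b) the real pair of an eigenvalue k. When the
  inequalities at a and b are added, the mixed terms cancel and |k|^2 (q a + q b) < q a + q b
  remains.\<close>

lemma stable_of_lyapunov_inequality:
  assumes M: "M \<in> carrier_mat n n" and P: "P \<in> carrier_mat n n" "pos_def P"
    and dec: "\<And>v. v \<in> carrier_vec n \<Longrightarrow> v \<noteq> 0\<^sub>v n \<Longrightarrow> (M *\<^sub>v v) \<bullet> (P *\<^sub>v (M *\<^sub>v v)) < v \<bullet> (P *\<^sub>v v)"
  shows "complex_spectrum M \<subseteq> open_unit_disc"
proof
  fix k assume "k \<in> complex_spectrum M"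
  from complex_spectrum_real_pair[OF M this] obtain a b where
    ab: "a \<in> carrier_vec n" "b \<in> carrier_vec n" "a \<noteq> 0\<^sub>v n \<or> b \<noteq> 0\<^sub>v n"
    and Ma: "M *\<^sub>v a = Re k \<cdot>\<^sub>v a - Im k \<cdot>\<^sub>v b" and Mb: "M *\<^sub>v b = Im k \<cdot>\<^sub>v a + Re k \<cdot>\<^sub>v b" .
  note sym = pos_defD(1)[OF P(2,1)]
  let ?q = "\<lambda>v. v \<bullet> (P *\<^sub>v v)"
  have le: "?q (M *\<^sub>v v) \<le> ?q v" if "v \<in> carrier_vec n" for v
    using dec[OF that] that M P mult_mat_zero_vec[OF M] by (cases "v = 0\<^sub>v n") auto
  have pos: "?q a + ?q b > 0"
    using ab pos_defD(3,4)[OF P(2,1), of a] pos_defD(3,4)[OF P(2,1), of b] by fastforce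
  \<comment> \<open>One of a, b may vanish; strictness is then taken from the other.\<close>
  have "?q (M *\<^sub>v a) + ?q (M *\<^sub>v b) < ?q a + ?q b"
    using ab dec[of a] dec[of b] le[of a] le[of b] by fastforce
  moreover have "?q (M *\<^sub>v a) = Re k ^ 2 * ?q a - 2 * (Re k * Im k * (a \<bullet> (P *\<^sub>v b))) + Im k ^ 2 * ?q b"
    unfolding Ma using ab P
    by (simp add: quad_diff[OF sym P(1)] mult_mat_vec[OF P(1)] power2_eq_square)
  moreover have "?q (M *\<^sub>v b) = Im k ^ 2 * ?q a + 2 * (Re k * Im k * (a \<bullet> (P *\<^sub>v b))) + Re k ^ 2 * ?q b"
    unfolding Mb using ab P
    by (simp add: quad_add[OF sym P(1)] mult_mat_vec[OF P(1)] power2_eq_square)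
  ultimately have "(Re k ^ 2 + Im k ^ 2) * (?q a + ?q b) < 1 * (?q a + ?q b)"
    by (simp add: distrib_left distrib_right)
  hence "Re k ^ 2 + Im k ^ 2 < 1" using mult_less_cancel_right_pos[OF pos] by blast
  thus "k \<in> open_unit_disc"
    by (simp add: open_unit_disc_def cmod_def)
qed

text \<open>Completing the square in the lower part leaves \<delta> - x . P x, the Schur complement
  of the block \<open>mat_inv P\<close>.\<close>

lemma pos_def_block_iff:
  assumes P: "P \<in> carrier_mat n n" "pos_def P" and x: "x \<in> carrier_vec n"
  shows "pos_def (four_block_mat (mat 1 1 (\<lambda>_. \<delta>)) (mat_of_rows n [x]) (mat_of_cols n [x]) (mat_inv P))
    \<longleftrightarrow> x \<bullet> (P *\<^sub>v x) < \<delta>" (is "pos_def ?F \<longleftrightarrow> _")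
proof -
  note Pi = pos_def_inverse[OF P(2,1)]
  let ?r = "mat_of_rows n [x]" and ?c = "mat_of_cols n [x]" and ?d = "mat 1 1 (\<lambda>_. \<delta>)"
  have r: "?r \<in> carrier_mat 1 n" and c: "?c \<in> carrier_mat n 1" and rc: "?c = ?r\<^sup>T" and d: "?d \<in> carrier_mat 1 1"
    using x by (auto intro!: eq_matI simp: mat_of_rows_def mat_of_cols_def)
  have F: "?F \<in> carrier_mat (1 + n) (1 + n)" using d Pi(1) by (rule four_block_carrier_mat)
  have "?F\<^sup>T = ?F"
    using r c d Pi(1) rc pos_defD(2)[OF Pi(4,1)]
    by (subst transpose_four_block_mat[OF d r c Pi(1)]) (auto intro!: cong_four_block_mat eq_matI)
  hence sym: "symmetric ?F" using symmetric_carrier[OF F] by simp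
  have quad: "(a @\<^sub>v w) \<bullet> (?F *\<^sub>v (a @\<^sub>v w))
      = (\<delta> - x \<bullet> (P *\<^sub>v x)) * (a $ 0)\<^sup>2
        + (w + a $ 0 \<cdot>\<^sub>v (P *\<^sub>v x)) \<bullet> (mat_inv P *\<^sub>v (w + a $ 0 \<cdot>\<^sub>v (P *\<^sub>v x)))"
    if a: "a \<in> carrier_vec 1" and w: "w \<in> carrier_vec n" for a w
  proof -
    have Px: "P *\<^sub>v x \<in> carrier_vec n" using P x by simp
    have tPx: "a $ 0 \<cdot>\<^sub>v (P *\<^sub>v x) \<in> carrier_vec n" using Px by simp
    have 1: "a \<bullet> (?d *\<^sub>v a) = \<delta> * (a $ 0)\<^sup>2"
      using a by (simp add: scalar_prod_def power2_eq_square)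
    have 2: "a \<bullet> (?r *\<^sub>v w) = a $ 0 * (w \<bullet> x)"
      using a w x comm_scalar_prod[OF x w] by (simp add: scalar_prod_def mat_of_rows_def row_def)
    have 3: "w \<bullet> (?c *\<^sub>v a) = a $ 0 * (w \<bullet> x)"
      unfolding rc adjoint_right[OF r w a] by (rule 2)
    show ?thesis
      unfolding quad_four_block[OF d r c Pi(1) a w] 1 2 3
        quad_add[OF pos_defD(1)[OF Pi(4,1)] Pi(1) w tPx]
      using w Px x Pi(1) Pi(6)[OF x] comm_scalar_prod[OF x Px]
      by (simp add: mult_mat_vec[OF Pi(1)] algebra_simps power2_eq_square)
  qed
  show ?thesis
  proof
    assume pd: "pos_def ?F"
    \<comment> \<open>The vector (1, - P x) makes the square vanish and isolates the Schur
      complement.\<close>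
    let ?a = "unit_vec 1 0 :: real vec" and ?w = "- (P *\<^sub>v x)"
    have a: "?a \<in> carrier_vec 1" and w: "?w \<in> carrier_vec n" using P x by auto
    have "?a @\<^sub>v ?w \<noteq> 0\<^sub>v (1 + n)" unfolding append_vec_eq_0_iff[OF a w] by (auto simp: vec_eq_iff)
    hence "(?a @\<^sub>v ?w) \<bullet> (?F *\<^sub>v (?a @\<^sub>v ?w)) > 0" using pos_defD(3)[OF pd F] a w by blast
    moreover have "?w + ?a $ 0 \<cdot>\<^sub>v (P *\<^sub>v x) = 0\<^sub>v n" using P x by auto
    ultimately show "x \<bullet> (P *\<^sub>v x) < \<delta>"
      unfolding quad[OF a w] using mult_mat_zero_vec[OF Pi(1)] by simp
  next
    assume less: "x \<bullet> (P *\<^sub>v x) < \<delta>"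
    have "u \<bullet> (?F *\<^sub>v u) > 0" if u: "u \<in> carrier_vec (1 + n)" "u \<noteq> 0\<^sub>v (1 + n)" for u
    proof -
      obtain a w where a: "a \<in> carrier_vec 1" and w: "w \<in> carrier_vec n" and u_eq: "u = a @\<^sub>v w"
        using u(1) by (metis vec_first_last_append vec_first_carrier vec_last_carrier)
      have nz: "a \<noteq> 0\<^sub>v 1 \<or> w \<noteq> 0\<^sub>v n" using u(2) append_vec_eq_0_iff[OF a w] u_eq by auto
      have c: "w + a $ 0 \<cdot>\<^sub>v (P *\<^sub>v x) \<in> carrier_vec n" using w P x by simp
      note nn = pos_defD(4)[OF Pi(4,1) c]
      show ?thesis
      proof (cases "a $ 0 = 0")
        case False
        hence "(\<delta> - x \<bullet> (P *\<^sub>v x)) * (a $ 0)\<^sup>2 > 0" using less by simp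
        thus ?thesis unfolding u_eq quad[OF a w] using nn by linarith
      next
        case True
        hence "a = 0\<^sub>v 1" using a by (auto simp: vec_eq_iff)
        hence "w \<noteq> 0\<^sub>v n" using nz by simp
        moreover have "w + a $ 0 \<cdot>\<^sub>v (P *\<^sub>v x) = w" using True w P x by auto
        ultimately show ?thesis unfolding u_eq quad[OF a w] using True pos_defD(3)[OF Pi(4,1) w] by simp
      qed
    qed
    thus "pos_def ?F" using sym F by (auto simp: pos_def_def)
  qed
qed

section \<open>The guaranteed cost response\<close>

lemma feedback_mat_carrier:
  assumes "A \<in> carrier_mat n n"
  shows "feedback_mat J A B C F \<in> carrier_mat n n"
  using assms by (auto simp: feedback_mat_def)

lemma feedback_mat_remove:
  assumes A: "A \<in> carrier_mat n n" and J: "finite J" "i \<in> J"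
    and B: "B i \<in> carrier_mat n m" and C: "C i \<in> carrier_mat s n" and K: "K \<in> carrier_mat m s"
  shows "feedback_mat J A B C (F(i := K)) = feedback_mat (J - {i}) A B C F + B i * K * C i"
proof (rule eq_matI)
  have BKC: "B i * K * C i \<in> carrier_mat n n" using B C K by simp
  show "dim_row (feedback_mat J A B C (F(i := K))) = dim_row (feedback_mat (J - {i}) A B C F + B i * K * C i)"
    "dim_col (feedback_mat J A B C (F(i := K))) = dim_col (feedback_mat (J - {i}) A B C F + B i * K * C i)"
    using A BKC by (auto simp: feedback_mat_def)
  fix r c assume "r < dim_row (feedback_mat (J - {i}) A B C F + B i * K * C i)"
    "c < dim_col (feedback_mat (J - {i}) A B C F + B i * K * C i)"
  hence rc: "r < n" "c < n" using BKC by auto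
  have "(\<Sum>j\<in>J. (B j * (F(i := K)) j * C j) $$ (r, c))
      = (B i * K * C i) $$ (r, c) + (\<Sum>j\<in>J - {i}. (B j * F j * C j) $$ (r, c))"
    using J by (subst sum.remove[of _ i]) (auto intro!: sum.cong)
  thus "feedback_mat J A B C (F(i := K)) $$ (r, c)
      = (feedback_mat (J - {i}) A B C F + B i * K * C i) $$ (r, c)"
    using rc A carrier_matD[OF BKC] by (simp add: feedback_mat_def)
qed

context
  fixes n m s :: nat and A B C Q R K :: "real mat"
  assumes A: "A \<in> carrier_mat n n" and B: "B \<in> carrier_mat n m" and C: "C \<in> carrier_mat s n"
    and Q: "Q \<in> carrier_mat s s" "pos_semidef Q" and R: "R \<in> carrier_mat m m" "pos_def R"
    and K: "K \<in> carrier_mat m s"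
begin

abbreviation (input) "cost_weight \<equiv> C\<^sup>T * Q * C + C\<^sup>T * K\<^sup>T * R * K * C"

lemma cost_weight_properties:
  shows "cost_weight \<in> carrier_mat n n" "symmetric cost_weight"
    and "\<And>v. v \<in> carrier_vec n \<Longrightarrow> v \<bullet> (cost_weight *\<^sub>v v)
      = (C *\<^sub>v v) \<bullet> (Q *\<^sub>v (C *\<^sub>v v)) + ((K * C) *\<^sub>v v) \<bullet> (R *\<^sub>v ((K * C) *\<^sub>v v))"
    and "\<And>v. v \<in> carrier_vec n \<Longrightarrow> v \<bullet> (cost_weight *\<^sub>v v) \<ge> 0"
proof -
  have KC: "K * C \<in> carrier_mat m n" using K C by simp
  \<comment> \<open>The weight is bracketed to the left, as in \<open>cost\<close>; regrouping
    exhibits it as a sum of two congruences.\<close>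
  have eq: "cost_weight = C\<^sup>T * (Q * C) + (K * C)\<^sup>T * (R * (K * C))"
  proof -
    have X: "C\<^sup>T * K\<^sup>T \<in> carrier_mat n m" using C K by simp
    have XR: "C\<^sup>T * K\<^sup>T * R \<in> carrier_mat n m" using X R by simp
    have CT: "C\<^sup>T \<in> carrier_mat n s" using C by simp
    show ?thesis
      unfolding transpose_mult[OF K C] assoc_mult_mat[OF XR K C] assoc_mult_mat[OF X R(1) KC]
        assoc_mult_mat[OF CT Q(1) C] ..
  qed
  note c1 = congruence_form[OF Q(1) C] and c2 = congruence_form[OF R(1) KC]
  have symQ: "symmetric Q" using Q by (simp add: pos_semidef_def)
  show "cost_weight \<in> carrier_mat n n" unfolding eq using c1(1) c2(1) by simp
  show "symmetric cost_weight" unfolding eq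
    by (rule symmetric_add[OF c1(2)[OF symQ] c2(2)[OF pos_defD(1)[OF R(2,1)]] c1(1) c2(1)])
  fix v :: "real vec" assume v: "v \<in> carrier_vec n"
  show quad: "v \<bullet> (cost_weight *\<^sub>v v)
      = (C *\<^sub>v v) \<bullet> (Q *\<^sub>v (C *\<^sub>v v)) + ((K * C) *\<^sub>v v) \<bullet> (R *\<^sub>v ((K * C) *\<^sub>v v))"
    unfolding c1(3)[OF v, symmetric] c2(3)[OF v, symmetric] eq using v c1(1) c2(1)
    by (simp add: add_mult_distrib_mat_vec[of _ n n] scalar_prod_add_distrib[of _ n])
  show "v \<bullet> (cost_weight *\<^sub>v v) \<ge> 0"
    unfolding quad using Q C KC v pos_defD(4)[OF R(2,1), of "(K * C) *\<^sub>v v"]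
    by (auto simp: pos_semidef_def intro!: add_nonneg_nonneg)
qed

lemma closed_loop_form_cost_weight:
  assumes "v \<in> carrier_vec n"
  shows "closed_loop_form A B C Q R P (K * C) v
    = ((A + B * K * C) *\<^sub>v v) \<bullet> (P *\<^sub>v ((A + B * K * C) *\<^sub>v v)) - v \<bullet> (P *\<^sub>v v) + v \<bullet> (cost_weight *\<^sub>v v)"
  using A B C K assms by (simp add: closed_loop_form_def cost_weight_properties(3))

text \<open>The Lyapunov solution for the weight \<open>cost_weight + \<epsilon> I\<close> with \<open>\<epsilon>\<close> small enough keeps
  the value at \<open>x0\<close> below \<open>\<delta>\<close>.\<close>

lemma certificate_of_cost:
  assumes x0: "x0 \<in> carrier_vec n" and stable: "complex_spectrum (A + B * K * C) \<subseteq> open_unit_disc"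
    and cost: "(\<Sum>k. ereal (trajectory (A + B * K * C) x0 k \<bullet> (cost_weight *\<^sub>v trajectory (A + B * K * C) x0 k)))
      < ereal \<delta>"
  obtains P where "P \<in> carrier_mat n n" "pos_def P" "x0 \<bullet> (P *\<^sub>v x0) < \<delta>"
    "\<And>v. v \<in> carrier_vec n \<Longrightarrow> v \<noteq> 0\<^sub>v n \<Longrightarrow> closed_loop_form A B C Q R P (K * C) v < 0"
proof -
  define M where "M = A + B * K * C"
  have M: "M \<in> carrier_mat n n" using A B C K by (auto simp: M_def)
  define W where "W = cost_weight"
  note W = cost_weight_properties[folded W_def]
  note stable = stable[folded M_def]
  obtain P0 where P0: "P0 \<in> carrier_mat n n" "symmetric P0"
    and sums0: "\<And>x. x \<in> carrier_vec n \<Longrightarrow>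
      (\<lambda>k. trajectory M x k \<bullet> (W *\<^sub>v trajectory M x k)) sums (x \<bullet> (P0 *\<^sub>v x))"
    using lyapunov_solution_exists[OF M stable W(1,2)] by blast
  have "symmetric (1\<^sub>m n)" by (simp add: symmetric_def)
  then obtain P1 where P1: "P1 \<in> carrier_mat n n" "symmetric P1"
    and sums1: "\<And>x. x \<in> carrier_vec n \<Longrightarrow>
      (\<lambda>k. trajectory M x k \<bullet> (1\<^sub>m n *\<^sub>v trajectory M x k)) sums (x \<bullet> (P1 *\<^sub>v x))"
    using lyapunov_solution_exists[OF M stable one_carrier_mat] by blast
  have P0_nonneg: "x \<bullet> (P0 *\<^sub>v x) \<ge> 0" if "x \<in> carrier_vec n" for x
    using sums_le[OF _ sums_zero sums0[OF that]] W(4)[OF trajectory_carrier[OF M that]] by blast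
  have P1_nonneg: "x \<bullet> (P1 *\<^sub>v x) \<ge> 0" if "x \<in> carrier_vec n" for x
    using sums_le[OF _ sums_zero sums1[OF that]] trajectory_carrier[OF M that] scalar_prod_self_nonneg
    by fastforce
  \<comment> \<open>Removing the first term of the series from x leaves the series from M x. This
    gives the Lyapunov equation for P0 and P1 alike.\<close>
  have step: "x \<bullet> (X *\<^sub>v x) = x \<bullet> (Y *\<^sub>v x) + (M *\<^sub>v x) \<bullet> (X *\<^sub>v (M *\<^sub>v x))"
    if x: "x \<in> carrier_vec n" and sums: "\<And>x. x \<in> carrier_vec n \<Longrightarrow>
      (\<lambda>k. trajectory M x k \<bullet> (Y *\<^sub>v trajectory M x k)) sums (x \<bullet> (X *\<^sub>v x))" for x X Y
  proof -
    have "M *\<^sub>v x \<in> carrier_vec n" using M x by simp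
    from sums[OF this] have "(\<lambda>k. trajectory M x (Suc k) \<bullet> (Y *\<^sub>v trajectory M x (Suc k)))
        sums ((M *\<^sub>v x) \<bullet> (X *\<^sub>v (M *\<^sub>v x)))" unfolding trajectory_shift .
    from sums_Suc[OF this] have "(\<lambda>k. trajectory M x k \<bullet> (Y *\<^sub>v trajectory M x k))
        sums ((M *\<^sub>v x) \<bullet> (X *\<^sub>v (M *\<^sub>v x)) + x \<bullet> (Y *\<^sub>v x))" by simp
    from sums_unique2[OF sums[OF x] this] show ?thesis by simp
  qed
  have "(\<Sum>k. ereal (trajectory M x0 k \<bullet> (W *\<^sub>v trajectory M x0 k))) = ereal (x0 \<bullet> (P0 *\<^sub>v x0))"
    using sums0[OF x0] by (intro sums_unique[symmetric]) (simp only: sums_ereal)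
  hence less: "x0 \<bullet> (P0 *\<^sub>v x0) < \<delta>" using cost[folded M_def, folded W_def] by simp
  \<comment> \<open>A fraction of the gap \<delta> - x0 . P0 x0. The summand 1 avoids a zero
    denominator and leaves a slack of exactly \<epsilon> below \<delta>.\<close>
  define \<epsilon> where "\<epsilon> = (\<delta> - x0 \<bullet> (P0 *\<^sub>v x0)) / (x0 \<bullet> (P1 *\<^sub>v x0) + 1)"
  have \<epsilon>: "\<epsilon> > 0" using less P1_nonneg[OF x0] by (simp add: \<epsilon>_def)
  have "\<epsilon> * (x0 \<bullet> (P1 *\<^sub>v x0) + 1) = \<delta> - x0 \<bullet> (P0 *\<^sub>v x0)" using P1_nonneg[OF x0] by (simp add: \<epsilon>_def)
  hence small: "x0 \<bullet> (P0 *\<^sub>v x0) + \<epsilon> * (x0 \<bullet> (P1 *\<^sub>v x0)) < \<delta>" using \<epsilon> by (simp add: distrib_left)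
  define P where "P = P0 + \<epsilon> \<cdot>\<^sub>m P1"
  have P: "P \<in> carrier_mat n n" using P0 P1 by (simp add: P_def)
  have quad: "x \<bullet> (P *\<^sub>v x) = x \<bullet> (P0 *\<^sub>v x) + \<epsilon> * (x \<bullet> (P1 *\<^sub>v x))" if x: "x \<in> carrier_vec n" for x
  proof -
    have "(\<epsilon> \<cdot>\<^sub>m P1) *\<^sub>v x = \<epsilon> \<cdot>\<^sub>v (P1 *\<^sub>v x)" using P1 x by (auto simp: vec_eq_iff)
    thus ?thesis unfolding P_def using P0 P1 x
      by (simp add: add_mult_distrib_mat_vec[of _ n n] scalar_prod_add_distrib[of _ n])
  qed
  have neg: "closed_loop_form A B C Q R P (K * C) v = - \<epsilon> * (v \<bullet> v)" if v: "v \<in> carrier_vec n" for v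
  proof -
    have "M *\<^sub>v v \<in> carrier_vec n" using M v by simp
    thus ?thesis
      unfolding closed_loop_form_cost_weight[OF v] M_def[symmetric] W_def[symmetric] quad[OF v]
      using step[OF v sums0] step[OF v sums1] v by (simp add: quad algebra_simps)
  qed
  have "symmetric P"
  proof -
    have "(\<epsilon> \<cdot>\<^sub>m P1)\<^sup>T = \<epsilon> \<cdot>\<^sub>m P1\<^sup>T" by (rule eq_matI) auto
    hence "symmetric (\<epsilon> \<cdot>\<^sub>m P1)" using P1(2) by (simp add: symmetric_def)
    thus ?thesis unfolding P_def using P0 P1 by (intro symmetric_add) auto
  qed
  moreover have "v \<bullet> (P *\<^sub>v v) > 0" if v: "v \<in> carrier_vec n" "v \<noteq> 0\<^sub>v n" for v
  proof -
    \<comment> \<open>The first term of the series for P1 is v . v, so P1 supplies the definiteness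
      that P0 may lack.\<close>
    have "v \<bullet> (P1 *\<^sub>v v) \<ge> v \<bullet> v"
      using step[OF v(1) sums1] P1_nonneg[of "M *\<^sub>v v"] M v by simp
    hence "v \<bullet> (P1 *\<^sub>v v) > 0" using scalar_prod_self_pos[OF v] by linarith
    thus ?thesis unfolding quad[OF v(1)] using P0_nonneg[OF v(1)] \<epsilon> by (simp add: add_nonneg_pos)
  qed
  ultimately have "pos_def P" using P by (auto simp: pos_def_def)
  moreover have "closed_loop_form A B C Q R P (K * C) v < 0" if v: "v \<in> carrier_vec n" "v \<noteq> 0\<^sub>v n" for v
    unfolding neg[OF v(1)] using \<epsilon> scalar_prod_self_pos[OF v] by simp
  ultimately show thesis using that P small quad[OF x0] by simp
qed

text \<open>The decrease of v . P v along the closed loop dominates the stage cost, so the partial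
  sums telescope. The weak bound suffices for certificates with x0 . P x0 < \<delta>.\<close>

lemma cost_of_certificate:
  assumes x0: "x0 \<in> carrier_vec n" and P: "P \<in> carrier_mat n n" "pos_def P"
    and neg: "\<And>v. v \<in> carrier_vec n \<Longrightarrow> v \<noteq> 0\<^sub>v n \<Longrightarrow> closed_loop_form A B C Q R P (K * C) v < 0"
  shows "complex_spectrum (A + B * K * C) \<subseteq> open_unit_disc"
    and "(\<Sum>k. ereal (trajectory (A + B * K * C) x0 k \<bullet> (cost_weight *\<^sub>v trajectory (A + B * K * C) x0 k)))
      \<le> ereal (x0 \<bullet> (P *\<^sub>v x0))"
proof -
  define M where "M = A + B * K * C"
  have M: "M \<in> carrier_mat n n" using A B C K by (auto simp: M_def)
  define W where "W = cost_weight"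
  note W = cost_weight_properties[folded W_def]
  note form = closed_loop_form_cost_weight[of _ P, folded W_def M_def]
  show "complex_spectrum (A + B * K * C) \<subseteq> open_unit_disc"
    unfolding M_def[symmetric]
    by (rule stable_of_lyapunov_inequality[OF M P]) (use neg form W(4) in fastforce)
  \<comment> \<open>The strict inequality excludes v = 0, which a trajectory may reach; there both
    sides are 0.\<close>
  have le: "v \<bullet> (W *\<^sub>v v) \<le> v \<bullet> (P *\<^sub>v v) - (M *\<^sub>v v) \<bullet> (P *\<^sub>v (M *\<^sub>v v))" if v: "v \<in> carrier_vec n" for v
    using neg[OF v] form[OF v] M P W(1) v mult_mat_zero_vec[OF M]
    by (cases "v = 0\<^sub>v n") auto
  let ?x = "trajectory M x0"
  have x: "?x k \<in> carrier_vec n" for k by (rule trajectory_carrier[OF M x0])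
  have "(\<Sum>k<l. ?x k \<bullet> (W *\<^sub>v ?x k)) \<le> x0 \<bullet> (P *\<^sub>v x0) - ?x l \<bullet> (P *\<^sub>v ?x l)" for l
  proof (induction l)
    case (Suc l)
    thus ?case using le[OF x[of l]] by simp
  qed simp
  hence "(\<Sum>k<l. ?x k \<bullet> (W *\<^sub>v ?x k)) \<le> x0 \<bullet> (P *\<^sub>v x0)" for l
    using pos_defD(4)[OF P(2,1) x[of l]] by (smt (verit))
  thus "(\<Sum>k. ereal (trajectory (A + B * K * C) x0 k \<bullet> (cost_weight *\<^sub>v trajectory (A + B * K * C) x0 k)))
      \<le> ereal (x0 \<bullet> (P *\<^sub>v x0))"
    unfolding M_def[symmetric] W_def[symmetric]
    by (intro suminf_bound) (use W(4)[OF x] in auto)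
qed

end

theorem theorem7:
  fixes N n i :: nat and m s :: "nat \<Rightarrow> nat"
    and A :: "real mat" and B C Q R F :: "nat \<Rightarrow> real mat"
    and x0 :: "real vec" and \<delta> :: real
    and NC NB :: "real mat"
  assumes A: "A \<in> carrier_mat n n"
    and B: "\<And>j. j \<in> {1..N} \<Longrightarrow> B j \<in> carrier_mat n (m j)"
    and C: "\<And>j. j \<in> {1..N} \<Longrightarrow> C j \<in> carrier_mat (s j) n"
    and rank_C: "\<And>j. j \<in> {1..N} \<Longrightarrow> vec_space.rank (s j) (C j) = s j"
    and Q: "\<And>j. j \<in> {1..N} \<Longrightarrow> Q j \<in> carrier_mat (s j) (s j) \<and> pos_semidef (Q j)"
    and R: "\<And>j. j \<in> {1..N} \<Longrightarrow> R j \<in> carrier_mat (m j) (m j) \<and> pos_def (R j)"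
    and x0: "x0 \<in> carrier_vec n"
    and stabilizable: "stabilizing_profiles N m s A B C \<noteq> {}"
    and i: "i \<in> {1..N}"
    and \<delta>: "\<delta> > 0"
    and F: "\<And>j. j \<in> {1..N} - {i} \<Longrightarrow> F j \<in> carrier_mat (m j) (s j)"
    and NC: "orthonormal_kernel_basis NC (C_tilde n (m i) (s i) (C i))"
    and NB: "orthonormal_kernel_basis NB (B_tilde n (m i) (s i) (B i))"
  defines "Ai \<equiv> feedback_mat ({1..N} - {i}) A B C F"
  defines "g \<equiv> guaranteed_cost_response N m s A B C Q R x0 i \<delta> F"
  defines "\<P> \<equiv> set_P n (m i) (s i) Ai (C i) (Q i) (R i) x0 \<delta> NC NB"
  shows "(g \<noteq> {} \<and> (\<forall>K\<in>g. complex_spectrum (Ai + B i * K * C i) \<subseteq> open_unit_disc)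
            \<longleftrightarrow> \<P> \<noteq> {}) \<and>
         (\<P> \<noteq> {} \<longrightarrow>
            (\<forall>K\<in>g. \<exists>P\<in>\<P>. neg_def (lmi_mat n (m i) (s i) Ai (B i) (C i) (Q i) (R i) P K)))"
proof -
  note Bi = B[OF i] and Ci = C[OF i]
  have Qi: "Q i \<in> carrier_mat (s i) (s i)" "pos_semidef (Q i)" using Q[OF i] by auto
  have Ri: "R i \<in> carrier_mat (m i) (m i)" "pos_def (R i)" using R[OF i] by auto
  have Ai: "Ai \<in> carrier_mat n n" unfolding Ai_def by (rule feedback_mat_carrier[OF A])
  have closed_loop: "feedback_mat {1..N} A B C (F(i := K)) = Ai + B i * K * C i"
    if "K \<in> carrier_mat (m i) (s i)" for K
    unfolding Ai_def
    using feedback_mat_remove[of A n "{1..N}" i B "m i" C "s i" K F] A i Bi Ci that by simp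
  let ?W = "\<lambda>K. (C i)\<^sup>T * Q i * C i + (C i)\<^sup>T * K\<^sup>T * R i * K * C i"
  let ?x = "\<lambda>K. trajectory (Ai + B i * K * C i) x0"
  have g_iff: "K \<in> g \<longleftrightarrow> K \<in> carrier_mat (m i) (s i)
      \<and> (\<Sum>k. ereal (?x K k \<bullet> (?W K *\<^sub>v ?x K k))) < ereal \<delta>
      \<and> complex_spectrum (Ai + B i * K * C i) \<subseteq> open_unit_disc" for K
  proof (cases "K \<in> carrier_mat (m i) (s i)")
    case True
    hence "\<forall>j\<in>{1..N}. (F(i := K)) j \<in> carrier_mat (m j) (s j)" using F by auto
    thus ?thesis
      unfolding g_def guaranteed_cost_response_def mem_Collect_eq cost_def stabilizing_profiles_def
        Let_def closed_loop[OF True] by simp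
  next
    case False
    thus ?thesis by (simp add: g_def guaranteed_cost_response_def)
  qed
  have X_iff: "P \<in> set_X n (m i) (s i) Ai (C i) (Q i) (R i) NC \<longleftrightarrow>
    (\<forall>v\<in>carrier_vec n. v \<noteq> 0\<^sub>v n \<longrightarrow> C i *\<^sub>v v = 0\<^sub>v (s i) \<longrightarrow>
       (Ai *\<^sub>v v) \<bullet> (P *\<^sub>v (Ai *\<^sub>v v)) < v \<bullet> (P *\<^sub>v v))"
    if "P \<in> carrier_mat n n" "pos_def P" for P
    by (rule set_X_iff[OF Ai Ci Qi Ri that NC])
  have Y_iff: "mat_inv P \<in> set_Y n (m i) (s i) Ai (C i) (Q i) (R i) x0 \<delta> NB \<longleftrightarrow>
     x0 \<bullet> (P *\<^sub>v x0) < \<delta> \<and> neg_def (NB\<^sup>T * Phi2 n (m i) (s i) Ai (C i) (Q i) (R i) (mat_inv P) * NB)"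
    if P: "P \<in> carrier_mat n n" "pos_def P" for P
    using pos_def_inverse(1,4)[OF P(2,1)] pos_def_block_iff[OF P x0, of \<delta>] by (simp add: set_Y_def)
  \<comment> \<open>The same P shows that \<open>\<P>\<close> is nonempty and certifies K in the
    matrix inequality, so one construction serves both claims.\<close>
  have certificate: "\<exists>P\<in>\<P>. neg_def (lmi_mat n (m i) (s i) Ai (B i) (C i) (Q i) (R i) P K)"
    if Kg: "K \<in> g" for K
  proof -
    note Kg = Kg[unfolded g_iff]
    from Kg have K: "K \<in> carrier_mat (m i) (s i)" by blast
    have KC: "K * C i \<in> carrier_mat (m i) n" using K Ci by simp
    obtain P where P: "P \<in> carrier_mat n n" "pos_def P" and less: "x0 \<bullet> (P *\<^sub>v x0) < \<delta>"
      and neg: "\<And>v. v \<in> carrier_vec n \<Longrightarrow> v \<noteq> 0\<^sub>v n \<Longrightarrow>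
        closed_loop_form Ai (B i) (C i) (Q i) (R i) P (K * C i) v < 0"
      by (rule certificate_of_cost[OF Ai Bi Ci Qi Ri K x0, of \<delta>]) (use Kg in auto)
    have "(Ai *\<^sub>v v) \<bullet> (P *\<^sub>v (Ai *\<^sub>v v)) < v \<bullet> (P *\<^sub>v v)"
      if v: "v \<in> carrier_vec n" "v \<noteq> 0\<^sub>v n" "C i *\<^sub>v v = 0\<^sub>v (s i)" for v
    proof -
      \<comment> \<open>On ker C the output vanishes, so K C acts as the zero gain and its form
        becomes the uncontrolled one.\<close>
      have KCv: "(K * C i) *\<^sub>v v = 0\<^sub>v (m i)"
        unfolding assoc_mult_mat_vec[OF K Ci v(1)] v(3) by (rule mult_mat_zero_vec[OF K])
      have "(Ai + B i * (K * C i)) *\<^sub>v v = Ai *\<^sub>v v + B i *\<^sub>v ((K * C i) *\<^sub>v v)"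
        using Ai Bi KC v(1) by (simp add: add_mult_distrib_mat_vec[of _ n n] assoc_mult_mat_vec[of _ n "m i" _ n])
      also have "\<dots> = Ai *\<^sub>v v" unfolding KCv using Ai Bi v by simp
      finally show ?thesis
        using neg[OF v(1,2)] unfolding closed_loop_form_def KCv v(3) using Qi Ri by simp
    qed
    hence "P \<in> set_X n (m i) (s i) Ai (C i) (Q i) (R i) NC" using X_iff[OF P] by blast
    moreover have "mat_inv P \<in> set_Y n (m i) (s i) Ai (C i) (Q i) (R i) x0 \<delta> NB"
      using Y_iff[OF P] less Phi2_neg_def[OF Ai Ci Qi Ri P Bi NB KC neg] by blast
    ultimately have "P \<in> \<P>" using P by (simp add: \<P>_def set_P_def)
    thus ?thesis using lmi_neg_def[OF Ai Ci Qi Ri P Bi K neg] by blast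
  qed
  have response: "\<exists>K. K \<in> g" if "P \<in> \<P>" for P
  proof -
    from that have P: "P \<in> carrier_mat n n" "pos_def P"
      and X: "P \<in> set_X n (m i) (s i) Ai (C i) (Q i) (R i) NC"
      and Y: "mat_inv P \<in> set_Y n (m i) (s i) Ai (C i) (Q i) (R i) x0 \<delta> NB"
      by (auto simp: \<P>_def set_P_def)
    from Y have less: "x0 \<bullet> (P *\<^sub>v x0) < \<delta>"
      and Phi2: "neg_def (NB\<^sup>T * Phi2 n (m i) (s i) Ai (C i) (Q i) (R i) (mat_inv P) * NB)"
      by (auto simp: Y_iff[OF P])
    obtain L where L: "L \<in> carrier_mat (m i) n" and opt: "\<And>v. v \<in> carrier_vec n \<Longrightarrow>
        (B i)\<^sup>T *\<^sub>v (P *\<^sub>v ((Ai + B i * L) *\<^sub>v v)) + R i *\<^sub>v (L *\<^sub>v v) = 0\<^sub>v (m i)"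
      using exists_optimal_gain[OF Ai Bi Ri P] by blast
    have neg: "closed_loop_form Ai (B i) (C i) (Q i) (R i) P L v < 0" if "v \<in> carrier_vec n" "v \<noteq> 0\<^sub>v n" for v
      by (rule Phi2_neg_defD[OF Ai Ci Qi Ri P Bi NB L opt Phi2 that])
    obtain K where K: "K \<in> carrier_mat (m i) (s i)"
      and negK: "\<And>v. v \<in> carrier_vec n \<Longrightarrow> v \<noteq> 0\<^sub>v n \<Longrightarrow>
        closed_loop_form Ai (B i) (C i) (Q i) (R i) P (K * C i) v < 0"
      using exists_output_gain[OF Ai Bi Ci Qi Ri P full_row_rank_transpose_inj[OF Ci rank_C[OF i]] L opt neg]
        X[unfolded X_iff[OF P]] by blast
    note res = cost_of_certificate[OF Ai Bi Ci Qi Ri K x0 P negK]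
    have "K \<in> g" unfolding g_iff using K res(1) le_less_trans[OF res(2), of "ereal \<delta>"] less by simp
    thus ?thesis by blast
  qed
  \<comment> \<open>Membership in g includes stability, so the equivalence is one between
    nonemptiness of the two sets.\<close>
  have "g \<noteq> {} \<longleftrightarrow> \<P> \<noteq> {}" using certificate response by blast
  moreover have "\<forall>K\<in>g. complex_spectrum (Ai + B i * K * C i) \<subseteq> open_unit_disc" by (simp add: g_iff)
  ultimately show ?thesis using certificate by blast
qed

end
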